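(* Let $\Lambda=\{1,\lambda_2,\dots,\lambda_n\}$ be a multiset of non-zero complex numbers. There exist $d\in\mathbb{N}$ and a completely positive trace-preserving linear map $T$ on $\mathcal{M}_d(\mathbb{C})$ with full Kraus rank such that $\mathrm{spec}(T)\setminus\{0\}=\Lambda$ if and only if $|\lambda_j|<1$ for all $j\ge2$ and $\mu_k(\Lambda)>0$ for all $k\in\mathbb{N}$.
   Context: A completely positive map $T(\rho)=\sum_jK_j\rho K_j^\dagger$ on $\mathcal{M}_d(\mathbb{C})$ has full Kraus rank if the complex linear span of its Kraus operators $\{K_j\}$ is all of $\mathcal{M}_d(\mathbb{C})$; equivalently, its Choi matrix $(T\otimes\mathrm{id})(|\Omega\rangle\langle\Omega|)$, $|\Omega\rangle=\sum_i|ii\rangle$, has full rank. $\mu_k(\Lambda):=\sum_{\lambda\in\Lambda}\lambda^k$ with multiplicity. $\mathrm{spec}(T)$ is counted with algebraic multiplicity and $\mathrm{spec}(T)\setminus\{0\}$ removes all zeros. Trace-preserving: $\mathrm{tr}[T(X)]=\mathrm{tr}[X]$. *)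

theory Defs
  imports "Jordan_Normal_Form.Char_Poly" "HOL-Library.Multiset"
begin

definition dagger :: "complex mat \<Rightarrow> complex mat" where
  "dagger K = mat (dim_col K) (dim_row K) (\<lambda>(i,j). cnj (K $$ (j,i)))"

definition kraus_map :: "nat \<Rightarrow> complex mat list \<Rightarrow> complex mat \<Rightarrow> complex mat" where
  "kraus_map d Ks \<rho> =
     mat d d (\<lambda>(i,j). \<Sum>l<length Ks. (Ks ! l * \<rho> * dagger (Ks ! l)) $$ (i,j))"

definition is_kraus_family :: "nat \<Rightarrow> complex mat list \<Rightarrow> bool" where
  "is_kraus_family d Ks \<longleftrightarrow> (\<forall>K\<in>set Ks. K \<in> carrier_mat d d)"

definition mtrace :: "complex mat \<Rightarrow> complex" where
  "mtrace A = (\<Sum>i<dim_row A. A $$ (i,i))"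

definition trace_preserving :: "nat \<Rightarrow> (complex mat \<Rightarrow> complex mat) \<Rightarrow> bool" where
  "trace_preserving d T \<longleftrightarrow> (\<forall>X\<in>carrier_mat d d. mtrace (T X) = mtrace X)"

definition full_kraus_rank :: "nat \<Rightarrow> complex mat list \<Rightarrow> bool" where
  "full_kraus_rank d Ks \<longleftrightarrow>
     (\<forall>X\<in>carrier_mat d d. \<exists>c :: nat \<Rightarrow> complex.
        \<forall>i<d. \<forall>j<d. X $$ (i,j) = (\<Sum>l<length Ks. c l * (Ks ! l) $$ (i,j)))"

definition mat_unit :: "nat \<Rightarrow> nat \<Rightarrow> nat \<Rightarrow> complex mat" where
  "mat_unit d a b = mat d d (\<lambda>(i,j). if i = a \<and> j = b then 1 else 0)"

text \<open>Representing matrix (d^2 x d^2) of a linear map T on M_d(C) w.r.t. the basis of matrix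
  units E_ab, with (i,j) indexed as i*d+j.\<close>
definition superop_matrix :: "nat \<Rightarrow> (complex mat \<Rightarrow> complex mat) \<Rightarrow> complex mat" where
  "superop_matrix d T = mat (d*d) (d*d)
     (\<lambda>(p,q). T (mat_unit d (q div d) (q mod d)) $$ (p div d, p mod d))"

definition alg_mult :: "nat \<Rightarrow> (complex mat \<Rightarrow> complex mat) \<Rightarrow> complex \<Rightarrow> nat" where
  "alg_mult d T x = order x (char_poly (superop_matrix d T))"

definition nonzero_spec_eq :: "nat \<Rightarrow> (complex mat \<Rightarrow> complex mat) \<Rightarrow> complex multiset \<Rightarrow> bool" where
  "nonzero_spec_eq d T \<Lambda> \<longleftrightarrow> (\<forall>x. x \<noteq> 0 \<longrightarrow> alg_mult d T x = count \<Lambda> x) \<and> count \<Lambda> 0 = 0"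

definition power_sum :: "nat \<Rightarrow> complex multiset \<Rightarrow> complex" where
  "power_sum k \<Lambda> = sum_mset (image_mset (\<lambda>x. x ^ k) \<Lambda>)"

end

theory Submission
  imports Defs "Jordan_Normal_Form.Schur_Decomposition"
    "HOL-Computational_Algebra.Computational_Algebra"
begin

text \<open>
  Both directions work with traces of powers, which determine the nonzero spectrum with multiplicities.

  Necessity: the trace of \<open>T\<^sup>k\<close> is the sum of \<open>\<bar>tr W\<bar>\<^sup>2\<close> over all words \<open>W\<close> of length \<open>k\<close> in the Kraus
  operators. These words again span all matrices, so the sum is positive. Full Kraus rank also allows to
  split \<open>T = c tr(\<cdot>) 1 + T'\<close> with \<open>c > 0\<close> and \<open>T'\<close> completely positive. Since \<open>T'\<close> multiplies the trace by
  \<open>r = 1 - c d\<close>, the traces of its powers are \<open>O(r\<^sup>k)\<close>, and they differ from the power sums of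
  \<open>\<lambda>\<^sub>2, \<dots>, \<lambda>\<^sub>n\<close> only by \<open>r\<^sup>k\<close>. Hence \<open>\<bar>\<lambda>\<^sub>j\<bar> \<le> r < 1\<close>.

  Sufficiency follows Laffey's constructive version of the Boyle--Handelman theorem. For large \<open>N\<close>, a
  slight perturbation of \<open>\<Prod>(1 - \<lambda>\<^sub>j t)\<close> still has positive power sums \<open>\<sigma>\<^sub>k\<close>, and the Hessenberg matrix with
  entries \<open>\<sigma>\<^sub>i\<^sub>-\<^sub>j\<^sub>+\<^sub>1 / N\<close> on and below the diagonal and \<open>i / N\<close> above it has nonzero spectrum \<open>\<Lambda>\<close>.
  Conjugation by small shears makes all its entries positive, a Perron eigenvector makes it stochastic,
  and a positive stochastic matrix is a channel of full Kraus rank.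
\<close>

subsection \<open>Power sums\<close>

text \<open>In the sufficiency direction infinitely many inequalities have to survive the
  perturbation. The Hessenberg matrix built from the unperturbed power sums would have
  \<open>p_j N! / ((N - j)! N^j)\<close> in place of the coefficient \<open>p_j\<close> of \<Prod>(1
  - \<lambda> t). Dividing by this factor beforehand makes the spectrum exact, but moves the numbers
  whose power sums must be positive. The factor tends to 1 for fixed j, and convergence settles each
  single exponent k. Uniformity in k comes from a gap: one perturbed number stays near 1 and all
  others remain in a disc of radius less than 1. Enlarging N only adds zeros to the spectrum, and so
  does the passage from an N by N stochastic matrix to a channel, since off-diagonal entries are
  annihilated. This is why only the non-zero spectrum can be prescribed and the dimension is left
  free.\<close>

definition recip_poly :: "complex multiset \<Rightarrow> complex poly" where
  "recip_poly L = (\<Prod>z\<in>#L. [:1, -z:])"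

lemma recip_poly_simps [simp]: "recip_poly {#} = 1" "recip_poly (add_mset z L) = [:1, -z:] * recip_poly L"
  by (simp_all add: recip_poly_def)

lemma power_sum_simps [simp]:
  "power_sum k {#} = 0" "power_sum k (add_mset z L) = z ^ k + power_sum k L"
  by (simp_all add: power_sum_def)

text \<open>Logarithmic derivative: a factor \<open>1 - z t\<close> contributes
  \<open>- z / (1 - z t)\<close>, a geometric series. The multiplied-out form avoids quotients of
  power series.\<close>

lemma fps_deriv_recip_poly:
  "fps_deriv (fps_of_poly (recip_poly L)) = - fps_of_poly (recip_poly L) * Abs_fps (\<lambda>k. power_sum (Suc k) L)"
proof (induction L)
  case empty
  show ?case by (simp add: fps_eq_iff)
next
  case (add z L)
  let ?S = "Abs_fps (\<lambda>k. power_sum (Suc k) L)" and ?G = "Abs_fps (\<lambda>k. z ^ Suc k)"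
  let ?p = "fps_of_poly (recip_poly L)" and ?l = "1 - fps_const z * fps_X :: complex fps"
  have lin: "fps_of_poly [:1, -z:] = ?l"
    by (rule fps_ext) (simp add: fps_of_poly_nth coeff_pCons split: nat.splits)
  have S: "Abs_fps (\<lambda>k. power_sum (Suc k) (add_mset z L)) = ?G + ?S"
    by (rule fps_ext) simp
  have G: "?l * ?G = fps_const z"
  proof (rule fps_ext)
    fix n show "fps_nth (?l * ?G) n = fps_nth (fps_const z) n"
      by (cases n) (simp_all add: left_diff_distrib mult.assoc)
  qed
  have "fps_deriv (fps_of_poly (recip_poly (add_mset z L))) = fps_deriv (?l * ?p)"
    by (simp add: fps_of_poly_mult lin del: mult_pCons_left)
  also have "\<dots> = - fps_const z * ?p + ?l * (- ?p * ?S)"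
    by (simp add: add.IH algebra_simps)
  also have "- fps_const z * ?p = - (?l * ?G) * ?p"
    by (simp only: G)
  also have "- (?l * ?G) * ?p + ?l * (- ?p * ?S) = - (?l * ?p) * (?G + ?S)"
    by (simp only: distrib_left mult_minus_left mult_minus_right mult.assoc mult.commute mult.left_commute)
  finally show ?case
    unfolding S by (simp add: fps_of_poly_mult lin del: mult_pCons_left)
qed

lemma newton_identity:
  "of_nat j * coeff (recip_poly L) j = - (\<Sum>i=1..j. power_sum i L * coeff (recip_poly L) (j - i))"
proof (cases j)
  case (Suc m)
  have "fps_nth (fps_deriv (fps_of_poly (recip_poly L))) m
      = - fps_nth (Abs_fps (\<lambda>k. power_sum (Suc k) L) * fps_of_poly (recip_poly L)) m"
    unfolding fps_deriv_recip_poly by (simp add: mult.commute)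
  then have "of_nat j * coeff (recip_poly L) j = - (\<Sum>i=0..m. power_sum (Suc i) L * coeff (recip_poly L) (m - i))"
    by (simp add: Suc fps_mult_nth fps_of_poly_nth)
  also have "(\<Sum>i=0..m. power_sum (Suc i) L * coeff (recip_poly L) (m - i))
      = (\<Sum>i=1..j. power_sum i L * coeff (recip_poly L) (j - i))"
    unfolding Suc One_nat_def sum.shift_bounds_cl_Suc_ivl by simp
  finally show ?thesis .
qed simp

lemma sum_mset_isolated:
  fixes f :: "'a \<Rightarrow> 'b :: semiring_1"
  assumes "\<And>x. x \<in># A \<Longrightarrow> x \<noteq> z \<Longrightarrow> f x = 0"
  shows "(\<Sum>x\<in>#A. f x) = of_nat (count A z) * f z"
  using assms
proof (induction A)
  case (add x A)
  then show ?case by (cases "x = z") (auto simp: algebra_simps)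
qed simp

text \<open>Combining shifted power sums evaluates a test polynomial on the multiset. If
  \<open>q\<close> vanishes at all members but one, a single multiplicity is extracted.\<close>

lemma power_sum_poly:
  "(\<Sum>e\<le>degree q. coeff q e * power_sum (k + e) A) = (\<Sum>x\<in>#A. x ^ k * poly q x)"
  by (induction A)
    (simp_all add: sum.distrib distrib_left poly_altdef sum_distrib_left power_add mult_ac)

lemma isolating_poly:
  fixes z :: "'a :: field"
  assumes "finite F"
  obtains q where "poly q z \<noteq> 0" "\<And>w. w \<in> F \<Longrightarrow> w \<noteq> z \<Longrightarrow> poly q w = 0"
proof
  let ?q = "\<Prod>w\<in>F - {z}. [:-w, 1:]"
  show "poly ?q z \<noteq> 0" using assms by (auto simp: poly_prod prod_zero_iff)
  show "poly ?q w = 0" if "w \<in> F" "w \<noteq> z" for w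
    using assms that by (auto simp: poly_prod prod_zero_iff)
qed

lemma count_eq_if_power_sums_eq:
  assumes "\<And>k. k \<ge> 1 \<Longrightarrow> power_sum k A = power_sum k B" and "z \<noteq> 0"
  shows "count A z = count B z"
proof -
  obtain q where q: "poly q z \<noteq> 0"
      "\<And>w. w \<in> set_mset A \<union> set_mset B \<Longrightarrow> w \<noteq> z \<Longrightarrow> poly q w = 0"
    using isolating_poly[of "set_mset A \<union> set_mset B" z] by auto
  \<comment> \<open>The factor \<open>x ^ 1\<close> keeps all exponents positive, where the
    hypothesis applies; it cancels in the end because \<open>z \<noteq> 0\<close>.\<close>
  have "(\<Sum>x\<in>#A. x ^ 1 * poly q x) = (\<Sum>x\<in>#B. x ^ 1 * poly q x)"
    unfolding power_sum_poly[symmetric] using assms(1) by simp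
  moreover have "(\<Sum>x\<in>#A. x ^ 1 * poly q x) = of_nat (count A z) * (z ^ 1 * poly q z)"
    by (rule sum_mset_isolated) (use q in auto)
  moreover have "(\<Sum>x\<in>#B. x ^ 1 * poly q x) = of_nat (count B z) * (z ^ 1 * poly q z)"
    by (rule sum_mset_isolated) (use q in auto)
  ultimately show ?thesis using q(1) assms(2) by simp
qed

lemma power_sum_cong_nonzero:
  assumes "\<And>z. z \<noteq> 0 \<Longrightarrow> count A z = count B z" and "k \<ge> 1"
  shows "power_sum k A = power_sum k B"
proof -
  have *: "power_sum k C = power_sum k {#z \<in># C. z \<noteq> 0#}" for C
    using assms(2) by (induction C) auto
  have "{#z \<in># A. z \<noteq> 0#} = {#z \<in># B. z \<noteq> 0#}"
    using assms(1) by (intro multiset_eqI) simp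
  then show ?thesis using *[of A] *[of B] by simp
qed

text \<open>Members of equal modulus could cancel in a power sum. Testing with a polynomial that
  isolates \<open>z\<close> removes the others: \<open>c * z ^ k\<close> with a fixed
  \<open>c \<noteq> 0\<close> is a combination of finitely many shifted power sums, hence
  O(\<open>r ^ k\<close>).\<close>

lemma cmod_le_if_power_sums_decay:
  assumes decay: "\<And>k. k \<ge> 1 \<Longrightarrow> cmod (power_sum k A) \<le> C * r ^ k"
    and r: "r \<ge> 0" and z: "z \<in># A"
  shows "cmod z \<le> r"
proof (rule ccontr)
  assume "\<not> cmod z \<le> r"
  then have zr: "r < cmod z" by simp
  obtain q where q: "poly q z \<noteq> 0" "\<And>w. w \<in> set_mset A \<Longrightarrow> w \<noteq> z \<Longrightarrow> poly q w = 0"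
    using isolating_poly[of "set_mset A" z] by auto
  define c where "c = of_nat (count A z) * poly q z"
  define D where "D = (\<Sum>e\<le>degree q. cmod (coeff q e) * (C * r ^ e))"
  have c: "cmod c > 0" using q z by (auto simp: c_def)
  have bound: "cmod c * cmod z ^ k \<le> D * r ^ k" if k: "k \<ge> 1" for k
  proof -
    have "c * z ^ k = (\<Sum>x\<in>#A. x ^ k * poly q x)"
      by (subst sum_mset_isolated[where z = z]) (use q in \<open>auto simp: c_def\<close>)
    also have "\<dots> = (\<Sum>e\<le>degree q. coeff q e * power_sum (k + e) A)"
      by (rule power_sum_poly[symmetric])
    finally have "cmod c * cmod z ^ k = cmod (\<Sum>e\<le>degree q. coeff q e * power_sum (k + e) A)"
      by (metis norm_mult norm_power)
    also have "\<dots> \<le> (\<Sum>e\<le>degree q. cmod (coeff q e) * (C * r ^ (k + e)))"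
      by (intro sum_norm_le) (use k in \<open>auto simp: norm_mult intro!: mult_left_mono decay\<close>)
    also have "\<dots> = D * r ^ k"
      by (simp add: D_def sum_distrib_left sum_distrib_right power_add mult_ac)
    finally show ?thesis .
  qed
  show False
  proof (cases "r = 0")
    case True
    then show False using bound[of 1] c zr by (simp add: mult_le_0_iff)
  next
    case False
    with r have r0: "r > 0" by simp
    then obtain k where k: "D / cmod c < (cmod z / r) ^ k"
      using real_arch_pow[of "cmod z / r"] zr by auto
    \<comment> \<open>The extra factor makes the exponent positive, as \<open>bound\<close>
      demands.\<close>
    also have "\<dots> \<le> (cmod z / r) ^ Suc k"
      using zr r0 by (intro power_increasing) auto
    also have "\<dots> \<le> D / cmod c"
      using bound[of "Suc k"] c r0 by (simp add: field_simps)
    finally show False by simp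
  qed
qed

subsection \<open>Traces of powers\<close>

lemma mult_mat_index:
  assumes "A \<in> carrier_mat n m" "B \<in> carrier_mat m l" "i < n" "j < l"
  shows "(A * B) $$ (i,j) = (\<Sum>k<m. A $$ (i,k) * B $$ (k,j))"
  using assms by (simp add: scalar_prod_def atLeast0LessThan)

lemma mtrace_mult_comm:
  assumes "A \<in> carrier_mat n m" "B \<in> carrier_mat m n"
  shows "mtrace (A * B) = mtrace (B * A)"
proof -
  have "mtrace (A * B) = (\<Sum>i<n. \<Sum>j<m. A $$ (i,j) * B $$ (j,i))"
    using assms by (simp add: mtrace_def scalar_prod_def atLeast0LessThan)
  also have "\<dots> = (\<Sum>j<m. \<Sum>i<n. B $$ (j,i) * A $$ (i,j))"
    by (subst sum.swap) (simp add: mult.commute)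
  also have "\<dots> = mtrace (B * A)"
    using assms by (simp add: mtrace_def scalar_prod_def atLeast0LessThan)
  finally show ?thesis .
qed

lemma upper_triangular_pow:
  fixes B :: "'a :: comm_ring_1 mat"
  assumes B: "B \<in> carrier_mat n n" "upper_triangular B"
  shows "(\<forall>i<n. \<forall>j<i. (B ^\<^sub>m k) $$ (i,j) = 0) \<and> (\<forall>i<n. (B ^\<^sub>m k) $$ (i,i) = B $$ (i,i) ^ k)"
proof (induction k)
  case 0
  then show ?case using B by auto
next
  case (Suc k)
  have Bk: "B ^\<^sub>m k \<in> carrier_mat n n" using B by simp
  have ij: "(B ^\<^sub>m Suc k) $$ (i,j) = (\<Sum>l<n. (B ^\<^sub>m k) $$ (i,l) * B $$ (l,j))"
    if "i < n" "j < n" for i j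
    using that B Bk by (simp add: scalar_prod_def atLeast0LessThan)
  have ut: "B $$ (l,j) = 0" if "j < l" "l < n" for l j
    using B that by (simp add: upper_triangular_def)
  show ?case
  proof (intro conjI allI impI)
    fix i j assume "i < n" "j < i"
    then show "(B ^\<^sub>m Suc k) $$ (i,j) = 0"
      unfolding ij[OF \<open>i < n\<close> order.strict_trans[OF \<open>j < i\<close> \<open>i < n\<close>]]
      using Suc ut by (intro sum.neutral) (metis lessThan_iff linorder_neqE_nat mult_zero_left mult_zero_right order.strict_trans)
  next
    fix i assume i: "i < n"
    have "(B ^\<^sub>m Suc k) $$ (i,i) = (\<Sum>l\<in>{i}. (B ^\<^sub>m k) $$ (i,l) * B $$ (l,i))"
      unfolding ij[OF i i]
    proof (rule sum.mono_neutral_right)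
      show "\<forall>l\<in>{..<n} - {i}. (B ^\<^sub>m k) $$ (i,l) * B $$ (l,i) = 0"
        using Suc ut i by (metis Diff_iff insertI1 lessThan_iff linorder_neqE_nat mult_zero_left mult_zero_right)
    qed (use i in auto)
    then show "(B ^\<^sub>m Suc k) $$ (i,i) = B $$ (i,i) ^ Suc k"
      using Suc i by (simp add: mult.commute)
  qed
qed

lemma order_prod_linear_factors:
  "Polynomial.order x (\<Prod>a\<leftarrow>as. [:- a, 1:]) = count (mset as) (x :: 'a :: idom)"
proof (induction as)
  case (Cons a as)
  have nz: "(\<Prod>a\<leftarrow>as. [:- a, 1:]) \<noteq> 0" for as :: "'a list"
    by (induction as) (simp_all del: mult_pCons_left)
  have "Polynomial.order x [:-a, 1:] = (if x = a then 1 else 0)"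
    using order_power_n_n[of a 1] by (auto intro!: order_0I)
  then show ?case
    using Cons nz[of "a # as"] by (auto simp: order_mult simp del: mult_pCons_left)
qed (simp add: order_0I)

text \<open>\<open>E\<close> is the diagonal of a Schur form: powers of a triangular matrix act
  entrywise on the diagonal, and similarity changes neither traces nor the characteristic
  polynomial.\<close>

lemma trace_pow_eq_power_sum:
  fixes A :: "complex mat"
  assumes A: "A \<in> carrier_mat n n"
  obtains E where "\<And>x. Polynomial.order x (char_poly A) = count E x" "\<And>k. mtrace (A ^\<^sub>m k) = power_sum k E"
proof -
  obtain es where es: "char_poly A = (\<Prod>a\<leftarrow>es. [:-a, 1:])"
    using char_poly_factorized[OF A] by auto
  obtain B where B: "B \<in> carrier_mat n n" "upper_triangular B" and sim: "similar_mat A B"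
    using schur_decomposition_exists[OF A es] by auto
  then obtain P Q where wit: "similar_mat_wit A B P Q" by (auto simp: similar_mat_def)
  note PQ = similar_mat_witD2[OF A wit]
  have 1: "Polynomial.order x (char_poly A) = count (mset (diag_mat B)) x" for x
    unfolding char_poly_similar[OF sim] char_poly_upper_triangular[OF B]
    by (rule order_prod_linear_factors)
  have 2: "mtrace (A ^\<^sub>m k) = power_sum k (mset (diag_mat B))" for k
  proof -
    have Bk: "B ^\<^sub>m k \<in> carrier_mat n n" using B by simp
    have "mtrace (A ^\<^sub>m k) = mtrace (P * (B ^\<^sub>m k * Q))"
      unfolding similar_mat_wit_pow_id[OF wit] using PQ Bk by (simp add: assoc_mult_mat[of _ n n _ n _ n])
    also have "\<dots> = mtrace (B ^\<^sub>m k * (Q * P))"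
      using PQ Bk by (subst mtrace_mult_comm[of _ n n]) (auto simp: assoc_mult_mat[of _ n n _ n _ n])
    also have "\<dots> = (\<Sum>i<n. B $$ (i,i) ^ k)"
      using PQ Bk upper_triangular_pow[OF B] by (simp add: mtrace_def)
    also have "\<dots> = power_sum k (mset (diag_mat B))"
      using B by (simp add: power_sum_def diag_mat_def sum_unfold_sum_mset atLeast0LessThan[symmetric]
          mset_map[symmetric] image_mset.compositionality comp_def del: mset_map)
        (simp add: sum_mset_sum_list[symmetric] comp_def atLeast_upt interv_sum_list_conv_sum_set_nat)
    finally show ?thesis .
  qed
  show thesis using that 1 2 by blast
qed

text \<open>Zero eigenvalues do not contribute to traces of positive powers, so \<open>E\<close>
  need not have \<open>n\<close> members.\<close>

lemma nonzero_spectrum_iff_traces: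
  assumes M: "M \<in> carrier_mat n n"
  shows "(\<forall>x. x \<noteq> 0 \<longrightarrow> Polynomial.order x (char_poly M) = count E x) \<longleftrightarrow>
    (\<forall>k\<ge>1. mtrace (M ^\<^sub>m k) = power_sum k E)"
proof -
  obtain F where F: "\<And>x. Polynomial.order x (char_poly M) = count F x" "\<And>k. mtrace (M ^\<^sub>m k) = power_sum k F"
    using trace_pow_eq_power_sum[OF M] by metis
  show ?thesis
    unfolding F by (metis count_eq_if_power_sums_eq power_sum_cong_nonzero)
qed

subsection \<open>Kraus families\<close>

text \<open>The sum of the Kronecker products of each \<open>K\<close> with its entrywise conjugate,
  which is the matrix of the Kraus map under row-major vectorisation.\<close>

definition cp_matrix :: "nat \<Rightarrow> complex mat list \<Rightarrow> complex mat" where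
  "cp_matrix d Ks = mat (d * d) (d * d)
     (\<lambda>(p,q). \<Sum>K\<leftarrow>Ks. K $$ (p div d, q div d) * cnj (K $$ (p mod d, q mod d)))"

lemma cp_matrix_carrier [simp]: "cp_matrix d Ks \<in> carrier_mat (d * d) (d * d)"
  by (simp add: cp_matrix_def)

lemma cp_matrix_index:
  "p < d * d \<Longrightarrow> q < d * d \<Longrightarrow> cp_matrix d Ks $$ (p,q) =
    (\<Sum>K\<leftarrow>Ks. K $$ (p div d, q div d) * cnj (K $$ (p mod d, q mod d)))"
  by (simp add: cp_matrix_def)

lemma div_mod_less_square:
  fixes p :: nat
  assumes "p < d * d"
  shows "p div d < d" "p mod d < d"
  using assms by (auto simp: less_mult_imp_div_less intro!: mod_less_divisor gr0I)

lemma sum_div_mod: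
  fixes f :: "nat \<Rightarrow> nat \<Rightarrow> 'a :: comm_monoid_add"
  shows "(\<Sum>p<d * d. f (p div d) (p mod d)) = (\<Sum>i<d. \<Sum>j<d. f i j)"
proof -
  have "(\<Sum>p<d * d. f (p div d) (p mod d)) = (\<Sum>i<d. \<Sum>p\<in>{i * d..<i * d + d}. f (p div d) (p mod d))"
    by (rule sum.nat_group[symmetric])
  also have "\<dots> = (\<Sum>i<d. \<Sum>j<d. f i j)"
  proof (rule sum.cong[OF refl])
    fix i
    have "(\<Sum>p\<in>{i * d..<i * d + d}. f (p div d) (p mod d))
        = (\<Sum>j<d. f ((j + i * d) div d) ((j + i * d) mod d))"
      using sum.shift_bounds_nat_ivl[of "\<lambda>p. f (p div d) (p mod d)" 0 "i * d" d]
      by (simp add: add.commute atLeast0LessThan)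
    also have "\<dots> = (\<Sum>j<d. f i j)"
      by (rule sum.cong) auto
    finally show "(\<Sum>p\<in>{i * d..<i * d + d}. f (p div d) (p mod d)) = (\<Sum>j<d. f i j)" .
  qed
  finally show ?thesis .
qed

lemma superop_kraus_map:
  assumes "is_kraus_family d Ks"
  shows "superop_matrix d (kraus_map d Ks) = cp_matrix d Ks"
proof (rule eq_matI)
  fix p q assume "p < dim_row (cp_matrix d Ks)" "q < dim_col (cp_matrix d Ks)"
  then have pq: "p < d * d" "q < d * d" by (auto simp: cp_matrix_def)
  note lt = div_mod_less_square[OF pq(1)] div_mod_less_square[OF pq(2)]
  let ?E = "mat_unit d (q div d) (q mod d)"
  have entry: "(K * ?E * dagger K) $$ (p div d, p mod d)
      = K $$ (p div d, q div d) * cnj (K $$ (p mod d, q mod d))" if "K \<in> set Ks" for K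
  proof -
    have K: "K \<in> carrier_mat d d" using assms that by (simp add: is_kraus_family_def)
    have KE: "(K * ?E) $$ (i,j) = (if j = q mod d then K $$ (i, q div d) else 0)" if "i < d" "j < d" for i j
      using that K lt by (simp add: mat_unit_def scalar_prod_def if_distrib[of "\<lambda>x. _ * x"]
          sum.delta atLeast0LessThan cong: if_cong)
    have "(K * ?E * dagger K) $$ (p div d, p mod d)
        = (\<Sum>j<d. (K * ?E) $$ (p div d, j) * cnj (K $$ (p mod d, j)))"
      using K lt by (simp add: dagger_def scalar_prod_def atLeast0LessThan mat_unit_def)
    also have "\<dots> = (\<Sum>j<d. if j = q mod d then K $$ (p div d, q div d) * cnj (K $$ (p mod d, j)) else 0)"
      by (rule sum.cong) (use KE lt in auto)
    also have "\<dots> = K $$ (p div d, q div d) * cnj (K $$ (p mod d, q mod d))"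
      using lt by simp
    finally show ?thesis .
  qed
  have "superop_matrix d (kraus_map d Ks) $$ (p,q)
      = (\<Sum>l<length Ks. (Ks ! l * ?E * dagger (Ks ! l)) $$ (p div d, p mod d))"
    using pq lt by (simp add: superop_matrix_def kraus_map_def)
  also have "\<dots> = (\<Sum>l<length Ks. Ks ! l $$ (p div d, q div d) * cnj (Ks ! l $$ (p mod d, q mod d)))"
    by (rule sum.cong) (use entry in auto)
  also have "\<dots> = cp_matrix d Ks $$ (p,q)"
    using pq by (simp add: cp_matrix_index sum_list_sum_nth atLeast0LessThan)
  finally show "superop_matrix d (kraus_map d Ks) $$ (p,q) = cp_matrix d Ks $$ (p,q)" .
qed (auto simp: superop_matrix_def cp_matrix_def)

lemma sum_sum_list_swap:
  fixes f :: "'a \<Rightarrow> 'b \<Rightarrow> 'c :: comm_monoid_add"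
  shows "(\<Sum>i\<in>I. \<Sum>x\<leftarrow>xs. f i x) = (\<Sum>x\<leftarrow>xs. \<Sum>i\<in>I. f i x)"
  by (induction xs) (simp_all add: sum.distrib)

lemma sum_list_product:
  fixes f :: "'a \<Rightarrow> 'c :: semiring_0"
  shows "(\<Sum>x\<leftarrow>xs. f x) * (\<Sum>y\<leftarrow>ys. g y) = (\<Sum>x\<leftarrow>xs. \<Sum>y\<leftarrow>ys. f x * g y)"
  by (simp add: sum_list_const_mult sum_list_mult_const)

lemma sum_list_comp:
  "(\<Sum>K\<leftarrow>[A * B. A \<leftarrow> As, B \<leftarrow> Bs]. f K) = (\<Sum>A\<leftarrow>As. \<Sum>B\<leftarrow>Bs. f (A * B) :: 'c :: comm_monoid_add)"
  by (induction As) (simp_all add: comp_def)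

text \<open>The mixed-product rule for Kronecker products: composing two maps multiplies their Kraus
  operators pairwise.\<close>

lemma cp_matrix_comp:
  assumes "is_kraus_family d As" "is_kraus_family d Bs"
  shows "cp_matrix d [A * B. A \<leftarrow> As, B \<leftarrow> Bs] = cp_matrix d As * cp_matrix d Bs"
proof (rule eq_matI)
  fix p q assume "p < dim_row (cp_matrix d As * cp_matrix d Bs)" "q < dim_col (cp_matrix d As * cp_matrix d Bs)"
  then have pq: "p < d * d" "q < d * d" by (auto simp: cp_matrix_def)
  note lt = div_mod_less_square[OF pq(1)] div_mod_less_square[OF pq(2)]
  let ?p = "p div d" and ?p' = "p mod d" and ?q = "q div d" and ?q' = "q mod d"
  have "(cp_matrix d As * cp_matrix d Bs) $$ (p,q)
      = (\<Sum>r<d * d. cp_matrix d As $$ (p,r) * cp_matrix d Bs $$ (r,q))"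
    using pq by (simp add: scalar_prod_def atLeast0LessThan cp_matrix_def)
  also have "\<dots> = (\<Sum>r<d * d. (\<Sum>A\<leftarrow>As. A $$ (?p, r div d) * cnj (A $$ (?p', r mod d)))
      * (\<Sum>B\<leftarrow>Bs. B $$ (r div d, ?q) * cnj (B $$ (r mod d, ?q'))))"
    by (rule sum.cong) (use pq in \<open>auto simp: cp_matrix_index\<close>)
  also have "\<dots> = (\<Sum>A\<leftarrow>As. \<Sum>B\<leftarrow>Bs. \<Sum>r<d * d.
      A $$ (?p, r div d) * cnj (A $$ (?p', r mod d)) * (B $$ (r div d, ?q) * cnj (B $$ (r mod d, ?q'))))"
    unfolding sum_list_product sum_sum_list_swap ..
  also have "\<dots> = (\<Sum>A\<leftarrow>As. \<Sum>B\<leftarrow>Bs. (A * B) $$ (?p, ?q) * cnj ((A * B) $$ (?p', ?q')))"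
  proof (intro arg_cong[where f = sum_list] map_cong refl)
    fix A B assume "A \<in> set As" "B \<in> set Bs"
    then have AB: "A \<in> carrier_mat d d" "B \<in> carrier_mat d d"
      using assms by (auto simp: is_kraus_family_def)
    have "(A * B) $$ (?p, ?q) * cnj ((A * B) $$ (?p', ?q'))
        = (\<Sum>i<d. \<Sum>j<d. A $$ (?p, i) * cnj (A $$ (?p', j)) * (B $$ (i, ?q) * cnj (B $$ (j, ?q'))))"
      using AB lt by (simp add: scalar_prod_def atLeast0LessThan sum_product mult_ac)
    then show "(\<Sum>r<d * d. A $$ (?p, r div d) * cnj (A $$ (?p', r mod d)) * (B $$ (r div d, ?q) * cnj (B $$ (r mod d, ?q'))))
        = (A * B) $$ (?p, ?q) * cnj ((A * B) $$ (?p', ?q'))"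
      by (simp only: sum_div_mod[of "\<lambda>i j. A $$ (?p, i) * cnj (A $$ (?p', j)) * (B $$ (i, ?q) * cnj (B $$ (j, ?q')))"])
  qed
  also have "\<dots> = cp_matrix d [A * B. A \<leftarrow> As, B \<leftarrow> Bs] $$ (p,q)"
    unfolding cp_matrix_index[OF pq] by (rule sum_list_comp[symmetric])
  finally show "cp_matrix d [A * B. A \<leftarrow> As, B \<leftarrow> Bs] $$ (p,q) = (cp_matrix d As * cp_matrix d Bs) $$ (p,q)" ..
qed (auto simp: cp_matrix_def)

lemma is_kraus_family_comp:
  "is_kraus_family d As \<Longrightarrow> is_kraus_family d Bs \<Longrightarrow> is_kraus_family d [A * B. A \<leftarrow> As, B \<leftarrow> Bs]"
  by (auto simp: is_kraus_family_def intro!: mult_carrier_mat)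

lemma cp_matrix_pow:
  assumes "is_kraus_family d Ks"
  shows "\<exists>Gs. is_kraus_family d Gs \<and> cp_matrix d Gs = cp_matrix d Ks ^\<^sub>m k"
proof (induction k)
  case 0
  have "cp_matrix d [1\<^sub>m d] = 1\<^sub>m (d * d)"
  proof (rule eq_matI)
    fix p q assume "p < dim_row (1\<^sub>m (d * d) :: complex mat)" "q < dim_col (1\<^sub>m (d * d) :: complex mat)"
    then have pq: "p < d * d" "q < d * d" by auto
    note lt = div_mod_less_square[OF pq(1)] div_mod_less_square[OF pq(2)]
    have "p = q \<longleftrightarrow> p div d = q div d \<and> p mod d = q mod d" by (metis div_mult_mod_eq)
    then show "cp_matrix d [1\<^sub>m d] $$ (p,q) = 1\<^sub>m (d * d) $$ (p,q)"
      using pq lt by (auto simp: cp_matrix_index)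
  qed (auto simp: cp_matrix_def)
  moreover have "is_kraus_family d [1\<^sub>m d]" by (simp add: is_kraus_family_def)
  moreover have "cp_matrix d Ks ^\<^sub>m 0 = 1\<^sub>m (d * d)" by (simp add: cp_matrix_def)
  ultimately show ?case by metis
next
  case (Suc k)
  then show ?case using assms
    by (metis is_kraus_family_comp cp_matrix_comp pow_mat.simps(2))
qed

text \<open>The dual form of full Kraus rank.\<close>

definition separating :: "nat \<Rightarrow> complex mat list \<Rightarrow> bool" where
  "separating d Ks \<longleftrightarrow> (\<forall>f. (\<forall>K\<in>set Ks. (\<Sum>i<d. \<Sum>j<d. f i j * K $$ (i,j)) = 0)
     \<longrightarrow> (\<forall>i<d. \<forall>j<d. f i j = 0))"

lemma separating_if_full_kraus_rank:
  assumes "full_kraus_rank d Ks"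
  shows "separating d Ks"
  unfolding separating_def
proof (intro allI impI)
  fix f :: "nat \<Rightarrow> nat \<Rightarrow> complex" and a b
  assume f: "\<forall>K\<in>set Ks. (\<Sum>i<d. \<Sum>j<d. f i j * K $$ (i,j)) = 0" and ab: "a < d" "b < d"
  have "mat_unit d a b \<in> carrier_mat d d" by (simp add: mat_unit_def)
  then obtain c where c: "\<And>i j. i < d \<Longrightarrow> j < d \<Longrightarrow> mat_unit d a b $$ (i,j) = (\<Sum>l<length Ks. c l * (Ks ! l) $$ (i,j))"
    using assms unfolding full_kraus_rank_def by metis
  have "f a b = (\<Sum>i<d. if i = a then f a b else 0)"
    using ab by simp
  also have "\<dots> = (\<Sum>i<d. \<Sum>j<d. if i = a \<and> j = b then f i j else 0)"
    by (rule sum.cong) (use ab in \<open>auto simp: sum.delta\<close>)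
  also have "\<dots> = (\<Sum>i<d. \<Sum>j<d. f i j * mat_unit d a b $$ (i,j))"
    by (intro sum.cong refl) (auto simp: mat_unit_def)
  also have "\<dots> = (\<Sum>i<d. \<Sum>j<d. \<Sum>l<length Ks. c l * (f i j * (Ks ! l) $$ (i,j)))"
    by (intro sum.cong refl) (simp add: c sum_distrib_left mult_ac)
  also have "\<dots> = (\<Sum>l<length Ks. c l * (\<Sum>i<d. \<Sum>j<d. f i j * (Ks ! l) $$ (i,j)))"
    unfolding sum_distrib_left by (subst sum.swap[of _ _ "{..<d}"], subst sum.swap[of _ _ "{..<d}"]) simp
  also have "\<dots> = 0" using f by simp
  finally show "f a b = 0" .
qed

text \<open>Separation is applied twice. For fixed \<open>A\<close> the functional X \<mapsto> f(A
  X) kills all of \<open>Bs\<close>, so all its coefficients vanish; each of these coefficients is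
  in turn a functional of \<open>A\<close> that kills all of \<open>As\<close>.\<close>

lemma separating_comp:
  assumes "is_kraus_family d As" "is_kraus_family d Bs" "separating d As" "separating d Bs"
  shows "separating d [A * B. A \<leftarrow> As, B \<leftarrow> Bs]"
  unfolding separating_def
proof (intro allI impI)
  fix f :: "nat \<Rightarrow> nat \<Rightarrow> complex" and a b
  assume f: "\<forall>K\<in>set [A * B. A \<leftarrow> As, B \<leftarrow> Bs]. (\<Sum>i<d. \<Sum>j<d. f i j * K $$ (i,j)) = 0"
    and ab: "a < d" "b < d"
  have left: "(\<Sum>i<d. f i b * A $$ (i,k)) = 0" if A: "A \<in> set As" and k: "k < d" for A k
  proof -
    have "(\<Sum>k<d. \<Sum>j<d. (\<Sum>i<d. f i j * A $$ (i,k)) * B $$ (k,j)) = 0" if B: "B \<in> set Bs" for B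
    proof -
      have AB: "A \<in> carrier_mat d d" "B \<in> carrier_mat d d"
        using A B assms by (auto simp: is_kraus_family_def)
      have "0 = (\<Sum>i<d. \<Sum>j<d. f i j * (A * B) $$ (i,j))"
        using f A B by force
      also have "\<dots> = (\<Sum>i<d. \<Sum>j<d. \<Sum>k<d. f i j * A $$ (i,k) * B $$ (k,j))"
        using AB by (intro sum.cong refl) (simp add: scalar_prod_def atLeast0LessThan sum_distrib_left mult_ac)
      also have "\<dots> = (\<Sum>i<d. \<Sum>k<d. \<Sum>j<d. f i j * A $$ (i,k) * B $$ (k,j))"
        by (intro sum.cong refl sum.swap)
      also have "\<dots> = (\<Sum>k<d. \<Sum>i<d. \<Sum>j<d. f i j * A $$ (i,k) * B $$ (k,j))"
        by (rule sum.swap)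
      also have "\<dots> = (\<Sum>k<d. \<Sum>j<d. \<Sum>i<d. f i j * A $$ (i,k) * B $$ (k,j))"
        by (intro sum.cong refl sum.swap)
      finally show ?thesis by (simp add: sum_distrib_right)
    qed
    then have "\<forall>k<d. \<forall>j<d. (\<Sum>i<d. f i j * A $$ (i,k)) = 0"
      using assms(4) unfolding separating_def by (elim allE[of _ "\<lambda>k j. \<Sum>i<d. f i j * A $$ (i,k)"]) blast
    then show ?thesis using ab k by blast
  qed
  \<comment> \<open>Any column \<open>k\<close> of \<open>A\<close> would serve here;
    \<open>b\<close> is merely an index known to be below \<open>d\<close>.\<close>
  have "\<forall>A\<in>set As. (\<Sum>i<d. \<Sum>k<d. (if k = b then f i b else 0) * A $$ (i,k)) = 0"
    using left ab by (simp add: if_distrib[of "\<lambda>x. x * _"] sum.delta cong: if_cong)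
  then have "\<forall>i<d. \<forall>k<d. (if k = b then f i b else 0) = 0"
    using assms(3) unfolding separating_def by (elim allE[of _ "\<lambda>i k. if k = b then f i b else 0"]) blast
  then have "(if b = b then f a b else 0) = 0" using ab by blast
  then show "f a b = 0" by simp
qed

text \<open>Exponents start at 1: the only word of length 0 is the identity, which separates nothing
  but scalars when \<open>d > 1\<close>.\<close>

lemma cp_matrix_pow_separating:
  assumes "is_kraus_family d Ks" "separating d Ks"
  shows "\<exists>Gs. is_kraus_family d Gs \<and> separating d Gs \<and> cp_matrix d Gs = cp_matrix d Ks ^\<^sub>m Suc k"
proof (induction k)
  case 0
  have "cp_matrix d Ks ^\<^sub>m Suc 0 = cp_matrix d Ks"
    using left_mult_one_mat[OF cp_matrix_carrier] by (simp add: cp_matrix_def)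
  then show ?case using assms by metis
next
  case (Suc k)
  then show ?case using assms
    by (metis is_kraus_family_comp separating_comp cp_matrix_comp pow_mat.simps(2))
qed

lemma mtrace_cp_matrix:
  assumes "is_kraus_family d Ks"
  shows "mtrace (cp_matrix d Ks) = of_real (\<Sum>K\<leftarrow>Ks. (cmod (mtrace K))\<^sup>2)"
proof -
  have K: "(\<Sum>p<d * d. K $$ (p div d, p div d) * cnj (K $$ (p mod d, p mod d))) = of_real ((cmod (mtrace K))\<^sup>2)"
    if "K \<in> set Ks" for K
  proof -
    have d: "dim_row K = d" using assms that by (auto simp: is_kraus_family_def)
    show ?thesis
      unfolding sum_div_mod[of "\<lambda>i j. K $$ (i,i) * cnj (K $$ (j,j))"] complex_norm_square
      by (simp add: mtrace_def d sum_product)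
  qed
  have "mtrace (cp_matrix d Ks) = (\<Sum>p<d * d. \<Sum>K\<leftarrow>Ks. K $$ (p div d, p div d) * cnj (K $$ (p mod d, p mod d)))"
    unfolding mtrace_def by (rule sum.cong) (auto simp: cp_matrix_def)
  also have "\<dots> = (\<Sum>K\<leftarrow>Ks. of_real ((cmod (mtrace K))\<^sup>2))"
    unfolding sum_sum_list_swap by (intro arg_cong[where f = sum_list] map_cong refl K)
  also have "\<dots> = of_real (\<Sum>K\<leftarrow>Ks. (cmod (mtrace K))\<^sup>2)"
    by (induction Ks) auto
  finally show ?thesis .
qed

text \<open>For \<open>d > 0\<close> the trace is itself a non-zero functional, so it cannot vanish
  on a whole separating family, and one non-zero term suffices in a sum of squares.\<close>

lemma mtrace_cp_matrix_pos:
  assumes Ks: "is_kraus_family d Ks" and sep: "separating d Ks" and d: "d > 0"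
  shows "Im (mtrace (cp_matrix d Ks)) = 0" "Re (mtrace (cp_matrix d Ks)) > 0"
proof -
  show "Im (mtrace (cp_matrix d Ks)) = 0"
    by (simp add: mtrace_cp_matrix[OF Ks])
  have "\<exists>K\<in>set Ks. mtrace K \<noteq> 0"
  proof (rule ccontr)
    assume "\<not> ?thesis"
    moreover have "dim_row K = d" if "K \<in> set Ks" for K
      using Ks that by (auto simp: is_kraus_family_def)
    ultimately have "\<forall>K\<in>set Ks. (\<Sum>i<d. \<Sum>j<d. (if i = j then 1 else 0) * K $$ (i,j)) = 0"
      by (auto simp: mtrace_def if_distrib[of "\<lambda>x. x * _"] sum.delta' cong: if_cong)
    then have "\<forall>i<d. \<forall>j<d. (if i = j then 1 else 0 :: complex) = 0"
      using sep unfolding separating_def by (elim allE[of _ "\<lambda>i j. if i = j then 1 else 0"]) blast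
    then have "(if 0 = (0::nat) then 1 else 0 :: complex) = 0" using d by blast
    then show False by simp
  qed
  then obtain K where K: "K \<in> set Ks" "mtrace K \<noteq> 0" by auto
  have "0 < (cmod (mtrace K))\<^sup>2" using K by simp
  also have "\<dots> \<le> (\<Sum>K\<leftarrow>Ks. (cmod (mtrace K))\<^sup>2)"
    using K by (intro member_le_sum_list) auto
  finally show "Re (mtrace (cp_matrix d Ks)) > 0"
    by (simp add: mtrace_cp_matrix[OF Ks])
qed

subsection \<open>Necessity\<close>

text \<open>The right-hand side is a difference, the left-hand side a sum of products
  \<open>x * cnj y\<close> and thus of Kraus form. The two vectors \<open>k\<close> and
  \<open>k'\<close> are needed because an entry of \<open>cp_matrix\<close> pairs two different
  entries of each Kraus operator.\<close>

lemma lagrange_identity_bilinear: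
  fixes c k k' :: "nat \<Rightarrow> complex"
  shows "(\<Sum>l<n. \<Sum>m<n. (cnj (c l) * k m - cnj (c m) * k l) * cnj (cnj (c l) * k' m - cnj (c m) * k' l))
    = 2 * ((\<Sum>l<n. c l * cnj (c l)) * (\<Sum>m<n. k m * cnj (k' m)) - (\<Sum>l<n. c l * k l) * cnj (\<Sum>l<n. c l * k' l))"
proof -
  let ?s = "\<lambda>f. \<Sum>l<n. \<Sum>m<n. f l m :: complex"
  have "?s (\<lambda>l m. (cnj (c l) * k m - cnj (c m) * k l) * cnj (cnj (c l) * k' m - cnj (c m) * k' l))
    = ?s (\<lambda>l m. (c l * cnj (c l)) * (k m * cnj (k' m))) - ?s (\<lambda>l m. (c m * k m) * cnj (c l * k' l))
      - (?s (\<lambda>l m. (c l * k l) * cnj (c m * k' m)) - ?s (\<lambda>l m. (k l * cnj (k' l)) * (c m * cnj (c m))))"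
    unfolding sum_subtractf[symmetric] by (intro sum.cong refl) (simp add: algebra_simps)
  also have "?s (\<lambda>l m. (c m * k m) * cnj (c l * k' l)) = ?s (\<lambda>l m. (c l * k l) * cnj (c m * k' m))"
    by (rule sum.swap)
  also have "?s (\<lambda>l m. (k l * cnj (k' l)) * (c m * cnj (c m))) = ?s (\<lambda>l m. (c l * cnj (c l)) * (k m * cnj (k' m)))"
    by (subst sum.swap) (simp add: mult.commute)
  finally show ?thesis
    by (simp only: sum_product[symmetric] cnj_sum) simp
qed

text \<open>The vectorised identity matrix. As a row it is the trace functional, so
  \<open>diag_ind d p * diag_ind d q\<close> is the matrix of X \<mapsto> tr(X) 1.\<close>

definition diag_ind :: "nat \<Rightarrow> nat \<Rightarrow> complex" where
  "diag_ind d p = (if p div d = p mod d then 1 else 0)"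

lemma mat_unit_carrier [simp]: "mat_unit d a b \<in> carrier_mat d d"
  by (simp add: mat_unit_def)

lemma sum_list_upt_sum: "(\<Sum>x\<leftarrow>[0..<n]. f x) = (\<Sum>x<n. f x)"
  by (simp add: interv_sum_list_conv_sum_set_nat atLeast0LessThan)

lemma sum_list_maps:
  "(\<Sum>x\<leftarrow>concat (map g xs). f x) = (\<Sum>y\<leftarrow>xs. \<Sum>x\<leftarrow>g y. f x :: 'c :: comm_monoid_add)"
  by (induction xs) simp_all

text \<open>Each matrix unit is a combination of the \<open>K\<^sub>l\<close>, so by Lagrange's identity a small multiple
  of the rank-one map with Kraus operators \<open>E\<^sub>a\<^sub>b\<close> can be split off, leaving a map in Kraus form.\<close>

lemma split_off_depolarizing:
  assumes Ks: "is_kraus_family d Ks" and full: "full_kraus_rank d Ks" and d: "d > 0"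
  obtains Gs c where "is_kraus_family d Gs" "c > 0"
    "\<And>p q. p < d * d \<Longrightarrow> q < d * d \<Longrightarrow>
      cp_matrix d Gs $$ (p,q) = cp_matrix d Ks $$ (p,q) - of_real c * diag_ind d p * diag_ind d q"
proof -
  let ?n = "length Ks"
  have "\<forall>a b. \<exists>c. \<forall>i<d. \<forall>j<d. mat_unit d a b $$ (i,j) = (\<Sum>l<?n. c l * (Ks ! l) $$ (i,j))"
    using full by (simp add: full_kraus_rank_def)
  then obtain c where c: "\<And>a b i j. i < d \<Longrightarrow> j < d \<Longrightarrow>
      mat_unit d a b $$ (i,j) = (\<Sum>l<?n. c a b l * (Ks ! l) $$ (i,j))"
    by metis
  define S where "S = (\<Sum>a<d. \<Sum>b<d. \<Sum>l<?n. (cmod (c a b l))\<^sup>2)"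
  have S: "S > 0"
  proof -
    have "\<exists>l<?n. c 0 0 l \<noteq> 0"
    proof (rule ccontr)
      assume "\<not> ?thesis"
      then have "mat_unit d 0 0 $$ (0,0) = 0" using c[of 0 0 0 0] d by simp
      then show False using d by (simp add: mat_unit_def)
    qed
    then have "0 < (\<Sum>l<?n. (cmod (c 0 0 l))\<^sup>2)"
      by (auto intro!: sum_pos2)
    also have "\<dots> \<le> (\<Sum>b<d. \<Sum>l<?n. (cmod (c 0 b l))\<^sup>2)"
      using d by (intro member_le_sum) (auto intro: sum_nonneg)
    also have "\<dots> \<le> S"
      unfolding S_def using d by (intro member_le_sum) (auto intro!: sum_nonneg)
    finally show ?thesis .
  qed
  \<comment> \<open>The 2 compensates for Lagrange's identity counting both \<open>(l, m)\<close>
    and \<open>(m, l)\<close>; the division by \<open>S\<close> gives \<open>cp_matrix d Ks\<close>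
    the coefficient 1.\<close>
  define s where "s = complex_of_real (sqrt (1 / (2 * S)))"
  have s: "s * cnj s = of_real (1 / (2 * S))"
    using S by (simp add: s_def flip: of_real_mult)
  define F where "F = (\<lambda>a b l m. mat d d (\<lambda>(i,j).
    s * (cnj (c a b l) * (Ks ! m) $$ (i,j) - cnj (c a b m) * (Ks ! l) $$ (i,j))))"
  define Gs where "Gs = concat (map (\<lambda>a. concat (map (\<lambda>b. concat (map (\<lambda>l.
    map (F a b l) [0..<?n]) [0..<?n])) [0..<d])) [0..<d])"
  have "is_kraus_family d Gs"
    by (auto simp: is_kraus_family_def Gs_def F_def)
  moreover have "1 / S > 0" using S by simp
  moreover have "cp_matrix d Gs $$ (p,q) = cp_matrix d Ks $$ (p,q) - of_real (1 / S) * diag_ind d p * diag_ind d q"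
    if pq: "p < d * d" "q < d * d" for p q
  proof -
    note lt = div_mod_less_square[OF pq(1)] div_mod_less_square[OF pq(2)]
    let ?p = "p div d" and ?p' = "p mod d" and ?q = "q div d" and ?q' = "q mod d"
    let ?k = "\<lambda>m. (Ks ! m) $$ (?p, ?q)" and ?k' = "\<lambda>m. (Ks ! m) $$ (?p', ?q')"
    have half: "of_real (1 / (2 * S)) * (2 * x) = of_real (1 / S) * x" for x :: complex
      by simp
    have Ks_pq: "cp_matrix d Ks $$ (p,q) = (\<Sum>m<?n. ?k m * cnj (?k' m))"
      using pq by (simp add: cp_matrix_index sum_list_sum_nth atLeast0LessThan)
    have "cp_matrix d Gs $$ (p,q) = (\<Sum>a<d. \<Sum>b<d. \<Sum>l<?n. \<Sum>m<?n. F a b l m $$ (?p, ?q) * cnj (F a b l m $$ (?p', ?q')))"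
      by (simp add: cp_matrix_index pq Gs_def sum_list_maps sum_list_upt_sum comp_def)
    also have "\<dots> = (\<Sum>a<d. \<Sum>b<d. s * cnj s * (\<Sum>l<?n. \<Sum>m<?n.
        (cnj (c a b l) * ?k m - cnj (c a b m) * ?k l) * cnj (cnj (c a b l) * ?k' m - cnj (c a b m) * ?k' l)))"
      unfolding sum_distrib_left using lt by (intro sum.cong refl) (simp add: F_def)
    also have "\<dots> = (\<Sum>a<d. \<Sum>b<d. of_real (1 / S) * ((\<Sum>l<?n. c a b l * cnj (c a b l)) * cp_matrix d Ks $$ (p,q)
        - mat_unit d a b $$ (?p, ?q) * cnj (mat_unit d a b $$ (?p', ?q'))))"
      unfolding lagrange_identity_bilinear s Ks_pq c[OF lt(1) lt(3)] c[OF lt(2) lt(4)] by (simp only: half)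
    also have "\<dots> = of_real (1 / S) * ((\<Sum>a<d. \<Sum>b<d. \<Sum>l<?n. c a b l * cnj (c a b l)) * cp_matrix d Ks $$ (p,q)
        - (\<Sum>a<d. \<Sum>b<d. mat_unit d a b $$ (?p, ?q) * cnj (mat_unit d a b $$ (?p', ?q'))))"
      by (simp only: sum_distrib_left[symmetric] sum_subtractf sum_distrib_right[symmetric])
    also have "(\<Sum>a<d. \<Sum>b<d. \<Sum>l<?n. c a b l * cnj (c a b l)) = of_real S"
      by (simp only: S_def of_real_sum complex_norm_square)
    \<comment> \<open>The matrix units are Kraus operators of X \<mapsto> tr(X) 1.\<close>
    also have "(\<Sum>a<d. \<Sum>b<d. mat_unit d a b $$ (?p, ?q) * cnj (mat_unit d a b $$ (?p', ?q')))
        = (\<Sum>a<d. \<Sum>b<d. if b = ?q then (if a = ?p then diag_ind d p * diag_ind d q else 0) else 0)"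
      using lt by (intro sum.cong refl) (auto simp: mat_unit_def diag_ind_def)
    also have "\<dots> = diag_ind d p * diag_ind d q"
      using lt by simp
    finally show ?thesis using S by (simp add: algebra_simps)
  qed
  ultimately show thesis by (rule that)
qed

lemma left_eigen_pow:
  fixes M :: "complex mat"
  assumes M: "M \<in> carrier_mat n n" and t: "\<And>q. q < n \<Longrightarrow> (\<Sum>p<n. t p * M $$ (p,q)) = r * t q"
    and q: "q < n"
  shows "(\<Sum>p<n. t p * (M ^\<^sub>m k) $$ (p,q)) = r ^ k * t q"
  using q
proof (induction k arbitrary: q)
  case 0
  then show ?case using M by (simp add: if_distrib[of "\<lambda>x. _ * x"] sum.delta cong: if_cong)
next
  case (Suc k)
  have Mk: "M ^\<^sub>m k \<in> carrier_mat n n" using M by simp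
  have "(\<Sum>p<n. t p * (M ^\<^sub>m Suc k) $$ (p,q)) = (\<Sum>p<n. \<Sum>j<n. t p * (M ^\<^sub>m k) $$ (p,j) * M $$ (j,q))"
    using Suc.prems by (intro sum.cong refl) (simp add: mult_mat_index[OF Mk M] sum_distrib_left mult.assoc)
  also have "\<dots> = (\<Sum>j<n. (\<Sum>p<n. t p * (M ^\<^sub>m k) $$ (p,j)) * M $$ (j,q))"
    by (subst sum.swap) (simp add: sum_distrib_right)
  also have "\<dots> = (\<Sum>j<n. r ^ k * (t j * M $$ (j,q)))"
    by (intro sum.cong refl) (simp add: Suc.IH)
  also have "\<dots> = r ^ k * (r * t q)"
    by (simp add: sum_distrib_left[symmetric] t Suc.prems)
  finally show ?case by (simp add: mult_ac)
qed

text \<open>Deflation: subtracting a multiple of \<open>u t\<close> moves the eigenvalue of the left eigenvector \<open>t\<close>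
  from \<open>1\<close> to \<open>r\<close> and keeps all others.\<close>

lemma mtrace_pow_deflate:
  fixes M N :: "complex mat"
  assumes M: "M \<in> carrier_mat n n" and N: "N \<in> carrier_mat n n"
    and NM: "\<And>p q. p < n \<Longrightarrow> q < n \<Longrightarrow> N $$ (p,q) = M $$ (p,q) - u p * t q"
    and tM: "\<And>q. q < n \<Longrightarrow> (\<Sum>p<n. t p * M $$ (p,q)) = t q"
    and tN: "\<And>q. q < n \<Longrightarrow> (\<Sum>p<n. t p * N $$ (p,q)) = r * t q"
    and q: "q < n" "t q = 1"
  shows "mtrace (N ^\<^sub>m k) = mtrace (M ^\<^sub>m k) - 1 + r ^ k"
proof -
  \<comment> \<open>The difference of the powers stays of the form \<open>w t\<close> with the same
    row \<open>t\<close>: multiplication by \<open>M\<close> on the right reproduces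
    \<open>t\<close>.\<close>
  have "\<exists>w. \<forall>p<n. \<forall>q<n. (N ^\<^sub>m k) $$ (p,q) = (M ^\<^sub>m k) $$ (p,q) - w p * t q" for k
  proof (induction k)
    case 0
    show ?case using M N by (intro exI[of _ "\<lambda>_. 0"]) simp
  next
    case (Suc k)
    then obtain w where w: "\<And>p q. p < n \<Longrightarrow> q < n \<Longrightarrow> (N ^\<^sub>m k) $$ (p,q) = (M ^\<^sub>m k) $$ (p,q) - w p * t q"
      by blast
    have Mk: "M ^\<^sub>m k \<in> carrier_mat n n" and Nk: "N ^\<^sub>m k \<in> carrier_mat n n" using M N by simp_all
    have "(N ^\<^sub>m Suc k) $$ (p,q) = (M ^\<^sub>m Suc k) $$ (p,q) - (w p + (\<Sum>j<n. (N ^\<^sub>m k) $$ (p,j) * u j)) * t q"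
      if pq: "p < n" "q < n" for p q
    proof -
      have "(N ^\<^sub>m Suc k) $$ (p,q) = (\<Sum>j<n. (N ^\<^sub>m k) $$ (p,j) * (M $$ (j,q) - u j * t q))"
        using pq by (simp add: mult_mat_index[OF Nk N] NM)
      also have "\<dots> = (\<Sum>j<n. (N ^\<^sub>m k) $$ (p,j) * M $$ (j,q)) - (\<Sum>j<n. (N ^\<^sub>m k) $$ (p,j) * u j) * t q"
        by (simp add: right_diff_distrib sum_subtractf sum_distrib_right mult.assoc)
      also have "(\<Sum>j<n. (N ^\<^sub>m k) $$ (p,j) * M $$ (j,q)) = (\<Sum>j<n. ((M ^\<^sub>m k) $$ (p,j) - w p * t j) * M $$ (j,q))"
        by (rule sum.cong) (simp_all add: w pq)
      also have "\<dots> = (M ^\<^sub>m Suc k) $$ (p,q) - w p * (\<Sum>j<n. t j * M $$ (j,q))"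
        using pq by (simp add: mult_mat_index[OF Mk M] left_diff_distrib sum_subtractf sum_distrib_left mult.assoc)
      finally show ?thesis using tM pq by (simp add: algebra_simps)
    qed
    then show ?case by (intro exI[of _ "\<lambda>p. w p + (\<Sum>j<n. (N ^\<^sub>m k) $$ (p,j) * u j)"]) blast
  qed
  then obtain w where w: "\<And>p q. p < n \<Longrightarrow> q < n \<Longrightarrow> (N ^\<^sub>m k) $$ (p,q) = (M ^\<^sub>m k) $$ (p,q) - w p * t q"
    by blast
  \<comment> \<open>The vector \<open>w\<close> need not be computed. Pairing with the left
    eigenvector \<open>t\<close> in a column where \<open>t\<close> is 1 determines \<Sum>
    \<open>w p * t p\<close>, and this is the trace of the correction.\<close>
  have "r ^ k = (\<Sum>p<n. t p * (N ^\<^sub>m k) $$ (p,q))"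
    using left_eigen_pow[OF N tN q(1), of k] q by simp
  also have "\<dots> = (\<Sum>p<n. t p * (M ^\<^sub>m k) $$ (p,q)) - (\<Sum>p<n. w p * t p)"
    using q by (simp add: w right_diff_distrib sum_subtractf mult.commute)
  also have "(\<Sum>p<n. t p * (M ^\<^sub>m k) $$ (p,q)) = 1"
    using left_eigen_pow[OF M _ q(1), of t 1 k] tM q by simp
  finally have "(\<Sum>p<n. w p * t p) = 1 - r ^ k" by simp
  moreover have "mtrace (N ^\<^sub>m k) = mtrace (M ^\<^sub>m k) - (\<Sum>p<n. w p * t p)"
    using M N by (simp add: mtrace_def w sum_subtractf)
  ultimately show ?thesis by simp
qed

lemma sum_diag_ind: "(\<Sum>p<d * d. diag_ind d p * f p) = (\<Sum>i<d. f (i * d + i))"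
proof -
  have "(\<Sum>p<d * d. diag_ind d p * f p) = (\<Sum>p<d * d. (\<lambda>i j. if j = i then f (i * d + j) else 0) (p div d) (p mod d))"
    by (rule sum.cong) (auto simp: diag_ind_def, metis div_mult_mod_eq)
  also have "\<dots> = (\<Sum>i<d. \<Sum>j<d. if j = i then f (i * d + j) else 0)"
    by (rule sum_div_mod)
  finally show ?thesis by simp
qed

lemma diag_index: "i < d \<Longrightarrow> i * d + i < d * d" for i d :: nat
  using mult_le_mono1[of "Suc i" d d] by simp

lemma trace_preserving_left_eigen:
  assumes Ks: "is_kraus_family d Ks" and tp: "trace_preserving d (kraus_map d Ks)" and q: "q < d * d"
  shows "(\<Sum>p<d * d. diag_ind d p * cp_matrix d Ks $$ (p,q)) = diag_ind d q"
proof -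
  let ?E = "mat_unit d (q div d) (q mod d)"
  note lt = div_mod_less_square[OF q]
  have "(\<Sum>p<d * d. diag_ind d p * cp_matrix d Ks $$ (p,q)) = (\<Sum>i<d. kraus_map d Ks ?E $$ (i,i))"
    unfolding sum_diag_ind superop_kraus_map[OF Ks, symmetric]
    by (rule sum.cong) (use q in \<open>auto simp: superop_matrix_def diag_index\<close>)
  also have "\<dots> = mtrace (kraus_map d Ks ?E)"
    by (simp add: mtrace_def kraus_map_def)
  also have "\<dots> = mtrace ?E"
    using tp by (auto simp: trace_preserving_def mat_unit_def)
  also have "\<dots> = (\<Sum>i<d. if i = q div d then diag_ind d q else 0)"
    unfolding mtrace_def by (rule sum.cong) (auto simp: mat_unit_def diag_ind_def)
  also have "\<dots> = diag_ind d q" using lt by simp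
  finally show ?thesis .
qed

text \<open>The hypothesis at a diagonal index (j, j) says that the j-th columns of all Kraus
  operators have total squared norm \<open>r\<close>; the rest is 2xy \<le> x^2 + y^2. The bound
  carries no dimension factor.\<close>

lemma cmod_cp_matrix_le:
  assumes eig: "\<And>q. q < d * d \<Longrightarrow> (\<Sum>p<d * d. diag_ind d p * cp_matrix d Gs $$ (p,q)) = of_real r * diag_ind d q"
    and pq: "p < d * d" "q < d * d"
  shows "cmod (cp_matrix d Gs $$ (p,q)) \<le> r"
proof -
  have col: "(\<Sum>G\<leftarrow>Gs. (cmod (G $$ (i,j)))\<^sup>2) \<le> r" if ij: "i < d" "j < d" for i j
  proof -
    have "complex_of_real (\<Sum>i<d. \<Sum>G\<leftarrow>Gs. (cmod (G $$ (i,j)))\<^sup>2)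
        = (\<Sum>i<d. cp_matrix d Gs $$ (i * d + i, j * d + j))"
    proof (subst of_real_sum, rule sum.cong[OF refl])
      fix i assume "i \<in> {..<d}"
      then have "cp_matrix d Gs $$ (i * d + i, j * d + j) = (\<Sum>G\<leftarrow>Gs. G $$ (i,j) * cnj (G $$ (i,j)))"
        using ij by (simp add: cp_matrix_index diag_index)
      also have "\<dots> = (\<Sum>G\<leftarrow>Gs. of_real ((cmod (G $$ (i,j)))\<^sup>2))"
        by (simp only: complex_norm_square)
      also have "\<dots> = of_real (\<Sum>G\<leftarrow>Gs. (cmod (G $$ (i,j)))\<^sup>2)"
        by (induction Gs) auto
      finally show "of_real (\<Sum>G\<leftarrow>Gs. (cmod (G $$ (i,j)))\<^sup>2) = cp_matrix d Gs $$ (i * d + i, j * d + j)" ..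
    qed
    also have "\<dots> = of_real r"
      using eig[OF diag_index[OF ij(2)]] ij unfolding sum_diag_ind by (simp add: diag_ind_def)
    finally have "(\<Sum>i<d. \<Sum>G\<leftarrow>Gs. (cmod (G $$ (i,j)))\<^sup>2) = r"
      by (simp only: of_real_eq_iff)
    moreover have "(\<Sum>G\<leftarrow>Gs. (cmod (G $$ (i,j)))\<^sup>2) \<le> (\<Sum>i<d. \<Sum>G\<leftarrow>Gs. (cmod (G $$ (i,j)))\<^sup>2)"
      by (rule member_le_sum[of i "{..<d}" "\<lambda>i. \<Sum>G\<leftarrow>Gs. (cmod (G $$ (i,j)))\<^sup>2"])
        (use ij in \<open>auto intro!: sum_list_nonneg\<close>)
    ultimately show ?thesis by simp
  qed
  note lt = div_mod_less_square[OF pq(1)] div_mod_less_square[OF pq(2)]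
  have "cmod (cp_matrix d Gs $$ (p,q))
      \<le> (\<Sum>G\<leftarrow>Gs. cmod (G $$ (p div d, q div d) * cnj (G $$ (p mod d, q mod d))))"
    unfolding cp_matrix_index[OF pq] by (induction Gs) (auto intro: norm_triangle_le)
  also have "\<dots> \<le> (\<Sum>G\<leftarrow>Gs. ((cmod (G $$ (p div d, q div d)))\<^sup>2 + (cmod (G $$ (p mod d, q mod d)))\<^sup>2) / 2)"
  proof (rule sum_list_mono)
    fix G :: "complex mat"
    show "cmod (G $$ (p div d, q div d) * cnj (G $$ (p mod d, q mod d)))
        \<le> ((cmod (G $$ (p div d, q div d)))\<^sup>2 + (cmod (G $$ (p mod d, q mod d)))\<^sup>2) / 2"
      using sum_squares_bound[of "cmod (G $$ (p div d, q div d))" "cmod (G $$ (p mod d, q mod d))"]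
      by (simp add: norm_mult)
  qed
  also have "\<dots> = ((\<Sum>G\<leftarrow>Gs. (cmod (G $$ (p div d, q div d)))\<^sup>2) + (\<Sum>G\<leftarrow>Gs. (cmod (G $$ (p mod d, q mod d)))\<^sup>2)) / 2"
    by (induction Gs) (auto simp: field_simps)
  also have "\<dots> \<le> r" using col[OF lt(1) lt(3)] col[OF lt(2) lt(4)] by simp
  finally show ?thesis .
qed

lemma full_kraus_rank_spectrum:
  assumes Ks: "is_kraus_family d Ks" and tp: "trace_preserving d (kraus_map d Ks)"
    and full: "full_kraus_rank d Ks" and spec: "nonzero_spec_eq d (kraus_map d Ks) (add_mset 1 L)"
  shows "(\<forall>z\<in>#L. cmod z < 1) \<and> (\<forall>k::nat. k \<ge> 1 \<longrightarrow> Im (power_sum k (add_mset 1 L)) = 0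
                                 \<and> Re (power_sum k (add_mset 1 L)) > 0)"
proof -
  define M where "M = cp_matrix d Ks"
  have M: "M \<in> carrier_mat (d * d) (d * d)" by (simp add: M_def)
  have spec': "\<forall>x. x \<noteq> 0 \<longrightarrow> Polynomial.order x (char_poly M) = count (add_mset 1 L) x"
    using spec by (simp add: nonzero_spec_eq_def alg_mult_def superop_kraus_map[OF Ks] M_def)
  then have tr: "mtrace (M ^\<^sub>m k) = power_sum k (add_mset 1 L)" if "k \<ge> 1" for k
    using nonzero_spectrum_iff_traces[OF M] that by blast
  \<comment> \<open>For \<open>d = 0\<close> the matrix is empty and its characteristic polynomial a
    non-zero constant, so 1 could not be an eigenvalue.\<close>
  have d: "d > 0"
  proof (rule ccontr)
    assume "\<not> d > 0"
    then have "power_sum 1 (add_mset 1 L) = 0" "count (add_mset 1 L) 1 > 0"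
      using tr[of 1] M by (auto simp: mtrace_def)
    moreover have "degree (char_poly M) = 0" "char_poly M \<noteq> 0"
      using \<open>\<not> d > 0\<close> degree_monic_char_poly[OF M] by auto
    ultimately show False
      using spec'[rule_format, of 1] order_degree[of "char_poly M" 1] by simp
  qed
  have pos: "Im (power_sum k (add_mset 1 L)) = 0 \<and> Re (power_sum k (add_mset 1 L)) > 0" if k: "k \<ge> 1" for k
  proof -
    obtain Gs where "is_kraus_family d Gs" "separating d Gs" "cp_matrix d Gs = M ^\<^sub>m k"
      using cp_matrix_pow_separating[OF Ks separating_if_full_kraus_rank[OF full], of "k - 1"] k
      unfolding M_def by (auto simp del: pow_mat.simps)
    then show ?thesis
      using mtrace_cp_matrix_pos[of d Gs] d tr[OF k] by simp
  qed
  obtain Gs c where Gs: "is_kraus_family d Gs" and c: "c > 0" and NM: "\<And>p q. p < d * d \<Longrightarrow> q < d * d \<Longrightarrow>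
      cp_matrix d Gs $$ (p,q) = M $$ (p,q) - of_real c * diag_ind d p * diag_ind d q"
    using split_off_depolarizing[OF Ks full d] unfolding M_def by metis
  define N where "N = cp_matrix d Gs"
  have N: "N \<in> carrier_mat (d * d) (d * d)" by (simp add: N_def)
  \<comment> \<open>The subtracted map X \<mapsto> c tr(X) 1 multiplies traces by
    \<open>c * d\<close>.\<close>
  define r where "r = 1 - c * real d"
  have tM: "(\<Sum>p<d * d. diag_ind d p * M $$ (p,q)) = diag_ind d q" if "q < d * d" for q
    unfolding M_def by (rule trace_preserving_left_eigen[OF Ks tp that])
  have tN: "(\<Sum>p<d * d. diag_ind d p * N $$ (p,q)) = of_real r * diag_ind d q" if q: "q < d * d" for q
  proof -
    have "(\<Sum>p<d * d. diag_ind d p * N $$ (p,q))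
        = (\<Sum>p<d * d. diag_ind d p * M $$ (p,q)) - of_real c * diag_ind d q * (\<Sum>p<d * d. diag_ind d p * diag_ind d p)"
      by (simp add: N_def NM q right_diff_distrib sum_subtractf sum_distrib_left mult_ac)
    also have "(\<Sum>p<d * d. diag_ind d p * diag_ind d p) = of_nat d"
      unfolding sum_diag_ind by (simp add: diag_ind_def)
    finally show ?thesis using tM[OF q] by (simp add: r_def algebra_simps)
  qed
  have bound: "cmod ((N ^\<^sub>m k) $$ (p,q)) \<le> r ^ k" if pq: "p < d * d" "q < d * d" for p q k
  proof -
    obtain Hs where "cp_matrix d Hs = N ^\<^sub>m k"
      using cp_matrix_pow[OF Gs] unfolding N_def by metis
    then show ?thesis
      using cmod_cp_matrix_le[of d Hs "r ^ k", OF _ pq] left_eigen_pow[OF N tN] by simp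
  qed
  \<comment> \<open>The definition of \<open>r\<close> does not show its sign, but \<open>r\<close>
    bounds the modulus of an entry of \<open>N\<close>.\<close>
  have r0: "r \<ge> 0"
    using order_trans[OF norm_ge_zero bound[of 0 0 1]] d by simp
  have "cmod (power_sum k L) \<le> (real (d * d) + 1) * r ^ k" if k: "k \<ge> 1" for k
  proof -
    have "mtrace (N ^\<^sub>m k) = mtrace (M ^\<^sub>m k) - 1 + of_real r ^ k"
      by (rule mtrace_pow_deflate[OF M N, where u = "\<lambda>p. of_real c * diag_ind d p" and t = "diag_ind d" and q = 0])
        (use tM tN d in \<open>auto simp: N_def NM diag_ind_def\<close>)
    then have "power_sum k L = mtrace (N ^\<^sub>m k) - of_real r ^ k"
      by (simp add: tr[OF k])
    then have "cmod (power_sum k L) \<le> cmod (mtrace (N ^\<^sub>m k)) + r ^ k"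
      using r0 by (metis norm_triangle_ineq4 norm_power norm_of_real abs_of_nonneg)
    also have "cmod (mtrace (N ^\<^sub>m k)) = cmod (\<Sum>p<d * d. (N ^\<^sub>m k) $$ (p,p))"
      using N by (simp add: mtrace_def)
    also have "\<dots> \<le> (\<Sum>p<d * d. r ^ k)"
      by (rule sum_norm_le) (use bound in auto)
    finally show ?thesis by (simp add: algebra_simps)
  qed
  then have "cmod z \<le> r" if "z \<in># L" for z
    using cmod_le_if_power_sums_decay r0 that by blast
  moreover have "r < 1" using c d by (simp add: r_def)
  ultimately have "\<forall>z\<in>#L. cmod z < 1" by (meson order.strict_trans1)
  then show ?thesis using pos by blast
qed

subsection \<open>Stability of positive power sums\<close>

lemma poly_recip_poly: "poly (recip_poly A) t = (\<Prod>a\<in>#A. 1 - a * t)"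
  by (induction A) (simp_all add: algebra_simps)

text \<open>The normalisation at 0 excludes the root 0, so each factor t - z can be rescaled to 1 -
  t/z.\<close>

lemma recip_poly_factorization:
  assumes "poly p 0 = 1"
  shows "\<exists>A. p = recip_poly A \<and> size A = degree p"
  using assms
proof (induction "degree p" arbitrary: p)
  case 0
  then obtain c where "p = [:c:]" using degree_eq_zeroE by metis
  with 0 show ?case by (intro exI[of _ "{#}"]) auto
next
  case (Suc m)
  then obtain z where z: "poly p z = 0"
    using fundamental_theorem_of_algebra constant_degree by (metis nat.distinct(1))
  with Suc.prems have z0: "z \<noteq> 0" by auto
  obtain q where q: "p = [:-z, 1:] * q" using z poly_eq_0_iff_dvd by (metis dvdE)
  define q' where "q' = Polynomial.smult (-z) q"
  have p: "p = [:1, - inverse z:] * q'"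
  proof -
    have "[:-z, 1:] = Polynomial.smult (-z) [:1, - inverse z:]" using z0 by simp
    then show ?thesis unfolding q q'_def by (metis mult_smult_left mult_smult_right)
  qed
  have "poly q' 0 = 1" using Suc.prems unfolding p by simp
  moreover from this have "q' \<noteq> 0" by auto
  then have "degree p = 1 + degree q'"
    unfolding p using z0 by (subst degree_mult_eq) auto
  ultimately obtain A where "q' = recip_poly A" "size A = m"
    using Suc.hyps(1)[of q'] Suc.hyps(2) by auto
  then show ?case
    using p Suc.hyps(2) by (intro exI[of _ "add_mset (inverse z) A"]) simp
qed

lemma coeff_recip_poly_0 [simp]: "coeff (recip_poly A) 0 = 1"
  by (induction A) simp_all

lemma degree_recip_poly_le: "degree (recip_poly A) \<le> size A"
proof (induction A)
  case (add a A)
  have "degree (recip_poly (add_mset a A)) \<le> degree [:1, -a:] + degree (recip_poly A)"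
    unfolding recip_poly_simps by (rule degree_mult_le)
  also have "\<dots> \<le> 1 + size A" using add by (intro add_mono) auto
  finally show ?case by simp
qed simp

lemma newton_recursion:
  assumes "k \<ge> 1"
  shows "power_sum k A = - of_nat k * coeff (recip_poly A) k - (\<Sum>i=1..<k. power_sum i A * coeff (recip_poly A) (k - i))"
proof -
  have "{1..k} = insert k {1..<k}" using assms by auto
  then have "of_nat k * coeff (recip_poly A) k = - (power_sum k A + (\<Sum>i=1..<k. power_sum i A * coeff (recip_poly A) (k - i)))"
    unfolding newton_identity by simp
  then show ?thesis by simp
qed

lemma power_sum_Reals:
  assumes "\<And>j. coeff (recip_poly A) j \<in> \<real>" "k \<ge> 1"
  shows "power_sum k A \<in> \<real>"
  using assms(2)
proof (induction k rule: less_induct)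
  case (less k)
  show ?case
    unfolding newton_recursion[OF less.prems]
    using less.IH assms(1) by (intro Reals_diff Reals_mult sum_in_Reals Reals_minus) auto
qed

lemma coeff_recip_poly_Reals:
  assumes "\<And>k. k \<ge> 1 \<Longrightarrow> power_sum k A \<in> \<real>"
  shows "coeff (recip_poly A) j \<in> \<real>"
proof (induction j rule: less_induct)
  case (less j)
  show ?case
  proof (cases "j = 0")
    case False
    have "of_nat j * coeff (recip_poly A) j \<in> \<real>"
      unfolding newton_identity using less assms by (intro Reals_mult sum_in_Reals Reals_minus) auto
    then have "of_nat j * coeff (recip_poly A) j / of_nat j \<in> \<real>" by (intro Reals_divide) auto
    then show ?thesis using False by simp
  qed simp
qed

text \<open>No roots have to be tracked: by Newton's recursion each power sum is a fixed polynomial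
  expression in finitely many coefficients.\<close>

lemma power_sum_tendsto:
  assumes "\<And>j. (\<lambda>N. coeff (recip_poly (A N)) j) \<longlonglongrightarrow> coeff (recip_poly B) j" "k \<ge> 1"
  shows "(\<lambda>N. power_sum k (A N)) \<longlonglongrightarrow> power_sum k B"
  using assms(2)
proof (induction k rule: less_induct)
  case (less k)
  show ?case
    unfolding newton_recursion[OF less.prems]
    using less.IH assms(1) by (intro tendsto_intros) auto
qed

lemma poly_eq_sum_atMost:
  fixes p :: "'a :: comm_semiring_1 poly"
  assumes "degree p \<le> n"
  shows "poly p x = (\<Sum>j\<le>n. coeff p j * x ^ j)"
  unfolding poly_altdef by (intro sum.mono_neutral_left) (use assms in \<open>auto simp: coeff_eq_0\<close>)

lemma prod_mset_nonneg:
  fixes f :: "'a \<Rightarrow> real"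
  assumes "\<And>a. a \<in># A \<Longrightarrow> 0 \<le> f a"
  shows "0 \<le> (\<Prod>a\<in>#A. f a)"
  using assms by (induction A) auto

lemma prod_mset_ge_power_size:
  fixes f :: "'a \<Rightarrow> real"
  assumes "\<And>a. a \<in># A \<Longrightarrow> m \<le> f a" "m \<ge> 0"
  shows "m ^ size A \<le> (\<Prod>a\<in>#A. f a)"
  using assms
proof (induction A)
  case (add a A)
  have "0 \<le> f a" using add.prems by force
  then have "m * m ^ size A \<le> f a * (\<Prod>a\<in>#A. f a)"
    using add by (intro mult_mono) auto
  then show ?case by simp
qed simp

lemma cmod_prod_mset: "cmod (\<Prod>a\<in>#A. f a) = (\<Prod>a\<in>#A. cmod (f a))"
  by (induction A) (simp_all add: norm_mult)

text \<open>The value at 1 has modulus \<Prod>|1 - a|, which bounds the smallest factor to the power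
  \<open>size A\<close>. That factor is below 1, so the exponent may be raised to \<open>n\<close>,
  which gives one estimate for a whole family of multisets.\<close>

lemma recip_poly_root_near_1:
  assumes "cmod (poly (recip_poly A) 1) < 1" "size A \<le> n"
  obtains \<alpha> where "\<alpha> \<in># A" "cmod (1 - \<alpha>) ^ n \<le> cmod (poly (recip_poly A) 1)"
proof -
  have ne: "A \<noteq> {#}" using assms(1) by auto
  let ?f = "\<lambda>a. cmod (1 - a)"
  obtain \<alpha> where \<alpha>: "\<alpha> \<in># A" "?f \<alpha> = Min (?f ` set_mset A)"
  proof -
    have "Min (?f ` set_mset A) \<in> ?f ` set_mset A"
      by (rule Min_in) (use ne in auto)
    then show thesis using that by force
  qed
  have "?f \<alpha> ^ size A \<le> (\<Prod>a\<in>#A. ?f a)"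
  proof (rule prod_mset_ge_power_size)
    show "?f \<alpha> \<le> ?f a" if "a \<in># A" for a
      unfolding \<alpha>(2) using that by (intro Min_le) auto
  qed simp
  also have "\<dots> = cmod (poly (recip_poly A) 1)"
    by (simp add: poly_recip_poly cmod_prod_mset)
  finally have *: "?f \<alpha> ^ size A \<le> cmod (poly (recip_poly A) 1)" .
  then have "?f \<alpha> < 1"
    using assms(1) by (metis not_less one_le_power order.strict_trans1)
  then have "?f \<alpha> ^ n \<le> ?f \<alpha> ^ size A"
    using assms(2) by (intro power_decreasing) auto
  with * \<alpha>(1) show thesis using that by force
qed

lemma cmod_power_sum_le:
  assumes "\<And>a. a \<in># A \<Longrightarrow> cmod a \<le> r"
  shows "cmod (power_sum k A) \<le> real (size A) * r ^ k"
  using assms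
proof (induction A)
  case (add a A)
  have "cmod (power_sum k (add_mset a A)) \<le> cmod a ^ k + cmod (power_sum k A)"
    by (simp add: norm_triangle_le norm_power)
  also have "\<dots> \<le> r ^ k + real (size A) * r ^ k"
    using add by (intro add_mono power_mono) auto
  finally show ?case by (simp add: algebra_simps)
qed simp

text \<open>A member \<open>b\<close> with |b| \<ge> r is a zero 1/b of the reciprocal polynomial in
  the closed disc of radius 1/r. There \<open>recip_poly L\<close> stays away from 0 by
  \<open>\<delta>\<close>, and with bounded degrees coefficientwise convergence is uniform on the
  disc.\<close>

lemma no_zeros_of_perturbation:
  assumes L: "\<And>z. z \<in># L \<Longrightarrow> cmod z < r" and r: "r > 0"
    and lim: "\<And>j. (\<lambda>N. coeff (recip_poly (B N)) j) \<longlonglongrightarrow> coeff (recip_poly L) j"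
    and n: "size L \<le> n" "\<forall>\<^sub>F N in sequentially. size (B N) \<le> n"
  shows "\<forall>\<^sub>F N in sequentially. \<forall>b\<in>#B N. cmod b < r"
proof -
  define \<delta> where "\<delta> = (\<Prod>z\<in>#L. 1 - cmod z / r)"
  have "\<delta> > 0"
    unfolding \<delta>_def using L r by (induction L) auto
  have lower: "\<delta> \<le> cmod (poly (recip_poly L) t)" if t: "cmod t \<le> 1 / r" for t
  proof -
    have "(\<Prod>z\<in>#L. 1 - cmod z / r) \<le> (\<Prod>z\<in>#L. cmod (1 - z * t))"
      using L
    proof (induction L)
      case (add z L)
      have "cmod z * cmod t \<le> cmod z * (1 / r)" using t by (intro mult_left_mono) auto
      then have "1 - cmod z / r \<le> cmod (1 - z * t)"
        using norm_triangle_ineq2[of 1 "z * t"] by (simp add: norm_mult)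
      moreover have "cmod z / r < 1" using add.prems r by simp
      ultimately have "(1 - cmod z / r) * (\<Prod>z\<in>#L. 1 - cmod z / r) \<le> cmod (1 - z * t) * (\<Prod>z\<in>#L. cmod (1 - z * t))"
        using add.IH add.prems r
        by (intro mult_mono prod_mset_nonneg) (auto intro: less_imp_le)
      then show ?case by simp
    qed simp
    then show ?thesis by (simp add: \<delta>_def poly_recip_poly cmod_prod_mset)
  qed
  define D where "D = (\<lambda>N. \<Sum>j\<le>n. cmod (coeff (recip_poly (B N)) j - coeff (recip_poly L) j) * (1 / r) ^ j)"
  have "D \<longlonglongrightarrow> (\<Sum>j\<le>n. cmod (coeff (recip_poly L) j - coeff (recip_poly L) j) * (1 / r) ^ j)"
    unfolding D_def by (intro tendsto_intros lim)
  then have "\<forall>\<^sub>F N in sequentially. D N < \<delta>"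
    using \<open>\<delta> > 0\<close> by (intro order_tendstoD) auto
  then show ?thesis using n(2)
  proof eventually_elim
    case (elim N)
    have nz: "poly (recip_poly (B N)) t \<noteq> 0" if t: "cmod t \<le> 1 / r" for t
    proof
      assume "poly (recip_poly (B N)) t = 0"
      then have "cmod (poly (recip_poly L) t) = cmod (poly (recip_poly (B N)) t - poly (recip_poly L) t)" by simp
      also have "\<dots> = cmod (\<Sum>j\<le>n. (coeff (recip_poly (B N)) j - coeff (recip_poly L) j) * t ^ j)"
        using degree_recip_poly_le[of "B N"] degree_recip_poly_le[of L] elim n(1)
        by (simp add: poly_eq_sum_atMost[of _ n] left_diff_distrib sum_subtractf)
      also have "\<dots> \<le> D N"
        unfolding D_def using t
        by (intro sum_norm_le) (auto simp: norm_mult norm_power intro!: mult_left_mono power_mono)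
      finally show False using lower[OF t] elim by simp
    qed
    show ?case
    proof
      fix b assume b: "b \<in># B N"
      show "cmod b < r"
      proof (rule ccontr)
        assume br: "\<not> cmod b < r"
        then have "b \<noteq> 0" using r by auto
        then have "poly (recip_poly (B N)) (1 / b) = 0"
          using b by (auto simp: poly_recip_poly)
        moreover have "cmod (1 / b) \<le> 1 / r"
          using br r by (simp add: norm_divide divide_simps)
        ultimately show False using nz by blast
      qed
    qed
  qed
qed

lemma exists_radius_less_1:
  fixes F :: "complex set"
  assumes "finite F" "\<And>z. z \<in> F \<Longrightarrow> cmod z < 1"
  obtains r where "0 < r" "r < 1" "\<And>z. z \<in> F \<Longrightarrow> cmod z < r"
proof -
  let ?m = "Max (insert 0 (cmod ` F))"
  have "?m < 1" "0 \<le> ?m" using assms by (auto simp: Max_less_iff)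
  moreover have "cmod z \<le> ?m" if "z \<in> F" for z using assms that by (intro Max_ge) auto
  ultimately show thesis using that[of "(?m + 1) / 2"] by force
qed

lemma power_sums_pos_of_perturbation:
  assumes L: "\<And>z. z \<in># L \<Longrightarrow> cmod z < 1"
    and pos: "\<And>k. k \<ge> 1 \<Longrightarrow> Re (power_sum k (add_mset 1 L)) > 0"
    and real: "\<And>N j. coeff (recip_poly (A N)) j \<in> \<real>"
    and lim: "\<And>j. (\<lambda>N. coeff (recip_poly (A N)) j) \<longlonglongrightarrow> coeff (recip_poly (add_mset 1 L)) j"
    and size: "\<And>N. size (A N) \<le> n"
  shows "\<forall>\<^sub>F N in sequentially. \<forall>k\<ge>1. Re (power_sum k (A N)) > 0"
proof -
  define m where "m = n + size L + 1"
  have m: "size (A N) \<le> m" "m > 0" for N using size[of N] by (auto simp: m_def)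
  let ?P = "\<lambda>N. cmod (poly (recip_poly (A N)) 1)"
  have "(\<lambda>N. \<Sum>j\<le>m. coeff (recip_poly (A N)) j * 1 ^ j) \<longlonglongrightarrow> (\<Sum>j\<le>m. coeff (recip_poly (add_mset 1 L)) j * 1 ^ j)"
    by (intro tendsto_intros lim)
  also have "(\<Sum>j\<le>m. coeff (recip_poly (add_mset 1 L)) j * 1 ^ j) = poly (recip_poly (add_mset 1 L)) 1"
    using degree_recip_poly_le[of "add_mset 1 L"] by (intro poly_eq_sum_atMost[symmetric]) (auto simp: m_def simp del: recip_poly_simps)
  also have "\<dots> = 0" by simp
  also have "(\<lambda>N. \<Sum>j\<le>m. coeff (recip_poly (A N)) j * 1 ^ j) = (\<lambda>N. poly (recip_poly (A N)) 1)"
    using degree_recip_poly_le m(1) by (intro ext poly_eq_sum_atMost[symmetric]) (metis order_trans)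
  finally have "?P \<longlonglongrightarrow> 0" by (rule tendsto_norm_zero)
  \<comment> \<open>The premise makes the choice total; \<open>\<alpha> N\<close> and
    \<open>B N\<close> carry information only where \<open>?P N < 1\<close>, which is eventually
    always.\<close>
  have "\<exists>\<alpha> B. ?P N < 1 \<longrightarrow> A N = add_mset \<alpha> B \<and> cmod (1 - \<alpha>) ^ m \<le> ?P N" for N
    using recip_poly_root_near_1[OF _ m(1)] by (metis insert_DiffM)
  then obtain \<alpha> B where \<alpha>B: "\<And>N. ?P N < 1 \<Longrightarrow> A N = add_mset (\<alpha> N) (B N)"
    and \<alpha>_le: "\<And>N. ?P N < 1 \<Longrightarrow> cmod (1 - \<alpha> N) ^ m \<le> ?P N"
    by metis
  have P1: "\<forall>\<^sub>F N in sequentially. ?P N < 1"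
    using \<open>?P \<longlonglongrightarrow> 0\<close> by (intro order_tendstoD) auto
  have near: "\<forall>\<^sub>F N in sequentially. cmod (1 - \<alpha> N) < e" if "e > 0" for e
  proof -
    have "\<forall>\<^sub>F N in sequentially. ?P N < e ^ m"
      using \<open>?P \<longlonglongrightarrow> 0\<close> that by (intro order_tendstoD) auto
    with P1 show ?thesis
    proof eventually_elim
      case (elim N)
      then have "cmod (1 - \<alpha> N) ^ m < e ^ m" using \<alpha>_le[of N] by linarith
      then show ?case using that power_less_imp_less_base less_imp_le by blast
    qed
  qed
  have "(\<lambda>N. \<alpha> N) \<longlonglongrightarrow> 1"
    using near by (auto simp: tendsto_iff dist_norm norm_minus_commute)
  \<comment> \<open>Division by 1 - \<alpha> t read off coefficient by coefficient; in the limit it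
    becomes division by 1 - t.\<close>
  have limB: "(\<lambda>N. coeff (recip_poly (B N)) j) \<longlonglongrightarrow> coeff (recip_poly L) j" for j
  proof (induction j)
    case 0
    show ?case by simp
  next
    case (Suc j)
    have "(\<lambda>N. coeff (recip_poly (A N)) (Suc j) + \<alpha> N * coeff (recip_poly (B N)) j)
        \<longlonglongrightarrow> coeff (recip_poly (add_mset 1 L)) (Suc j) + 1 * coeff (recip_poly L) j"
      by (intro tendsto_intros lim Suc \<open>\<alpha> \<longlonglongrightarrow> 1\<close>)
    moreover have "\<forall>\<^sub>F N in sequentially. coeff (recip_poly (A N)) (Suc j) + \<alpha> N * coeff (recip_poly (B N)) j = coeff (recip_poly (B N)) (Suc j)"
      using P1
    proof eventually_elim
      case (elim N)
      show ?case unfolding \<alpha>B[OF elim] by simp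
    qed
    ultimately have "(\<lambda>N. coeff (recip_poly (B N)) (Suc j)) \<longlonglongrightarrow> coeff (recip_poly (add_mset 1 L)) (Suc j) + 1 * coeff (recip_poly L) j"
      by (rule Lim_transform_eventually)
    then show ?case by simp
  qed
  obtain r where r: "0 < r" "r < 1" "\<And>z. z \<in># L \<Longrightarrow> cmod z < r"
    using exists_radius_less_1[of "set_mset L"] L by auto
  have "\<forall>\<^sub>F N in sequentially. size (B N) \<le> m"
    using P1 by eventually_elim (use m \<alpha>B in \<open>metis size_add_mset Suc_leD\<close>)
  then have small: "\<forall>\<^sub>F N in sequentially. \<forall>b\<in>#B N. cmod b < r"
    by (intro no_zeros_of_perturbation[OF r(3) r(1) limB]) (auto simp: m_def)
  \<comment> \<open>\<open>s\<close> separates the dominant number from the others. Beyond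
    \<open>k0\<close> the at most \<open>m\<close> numbers of modulus below \<open>r\<close>
    contribute less than \<open>s ^ k\<close>, for all large N at once.\<close>
  define s where "s = (1 + r) / 2"
  have s: "r < s" "s < 1" using r by (auto simp: s_def)
  obtain k0 where k0: "real m < (s / r) ^ k0"
    using real_arch_pow[of "s / r"] s r by auto
  have "\<forall>\<^sub>F N in sequentially. \<forall>k\<in>{1..<k0}. Re (power_sum k (A N)) > 0"
  proof (rule eventually_ball_finite)
    show "\<forall>k\<in>{1..<k0}. \<forall>\<^sub>F N in sequentially. Re (power_sum k (A N)) > 0"
    proof
      fix k assume k: "k \<in> {1..<k0}"
      have "(\<lambda>N. Re (power_sum k (A N))) \<longlonglongrightarrow> Re (power_sum k (add_mset 1 L))"
        using k lim by (intro tendsto_Re power_sum_tendsto) auto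
      then show "\<forall>\<^sub>F N in sequentially. Re (power_sum k (A N)) > 0"
        using pos k by (intro order_tendstoD) auto
    qed
  qed simp
  moreover have "\<forall>\<^sub>F N in sequentially. cmod (1 - \<alpha> N) < 1 - s"
    using near s by simp
  ultimately show ?thesis using small P1
  proof eventually_elim
    case (elim N)
    have A: "A N = add_mset (\<alpha> N) (B N)" using \<alpha>B elim by blast
    have \<alpha>s: "cmod (\<alpha> N) > s"
      using norm_triangle_ineq2[of 1 "1 - \<alpha> N"] elim by simp
    \<comment> \<open>The coefficients are real, so a non-real \<open>\<alpha> N\<close> would force
      its conjugate into \<open>B N\<close>, whose members have modulus below
      \<open>r < s\<close>.\<close>
    have "\<alpha> N = cnj (\<alpha> N)"
    proof (rule ccontr)
      assume ne: "\<alpha> N \<noteq> cnj (\<alpha> N)"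
      let ?c = "cnj (\<alpha> N)"
      have nz: "\<alpha> N \<noteq> 0" "?c \<noteq> 0" using \<alpha>s s r by auto
      have "poly (recip_poly (A N)) (1 / \<alpha> N) = 0"
        unfolding A using nz by simp
      then have "cnj (poly (recip_poly (A N)) (1 / \<alpha> N)) = 0" by simp
      moreover have "cnj (poly (recip_poly (A N)) (1 / \<alpha> N)) = poly (recip_poly (A N)) (1 / ?c)"
        using real by (simp add: poly_altdef Reals_cnj_iff)
      ultimately have "poly (recip_poly (B N)) (1 / ?c) = 0"
        unfolding A using nz ne by (simp add: field_simps)
      then obtain b where "b \<in># B N" "1 - b * (1 / ?c) = 0"
        by (auto simp: poly_recip_poly)
      then have "?c \<in># B N" using nz by (simp add: field_simps)
      then show False using elim \<alpha>s s by fastforce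
    qed
    then obtain a where a: "\<alpha> N = of_real a" by (metis Reals_cnj_iff Reals_cases)
    have "cmod (of_real (1 - a)) < 1 - s" using elim a by simp
    then have "a > s" unfolding norm_of_real by linarith
    show ?case
    proof (intro allI impI)
      fix k :: nat assume k: "k \<ge> 1"
      show "Re (power_sum k (A N)) > 0"
      proof (cases "k < k0")
        case True
        then show ?thesis using elim k by simp
      next
        case False
        have "real (size (B N)) \<le> real m" using m(1)[of N] A by simp
        also have "\<dots> < (s / r) ^ k0" by (rule k0)
        also have "\<dots> \<le> (s / r) ^ k"
          using False s r by (intro power_increasing) auto
        finally have "real (size (B N)) * r ^ k < s ^ k"
          using r by (simp add: power_divide pos_less_divide_eq)
        also have "\<dots> \<le> a ^ k" using \<open>a > s\<close> s r by (intro power_mono) auto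
        finally have *: "real (size (B N)) * r ^ k < a ^ k" .
        have "cmod (power_sum k (B N)) \<le> real (size (B N)) * r ^ k"
          using elim by (intro cmod_power_sum_le) auto
        then have "- Re (power_sum k (B N)) < a ^ k"
          using * abs_Re_le_cmod[of "power_sum k (B N)"] by linarith
        then show ?thesis unfolding A by (simp add: a flip: of_real_power)
      qed
    qed
  qed
qed

subsection \<open>A Hessenberg matrix with prescribed spectrum\<close>

text \<open>The coefficient of \<open>t\<^sup>n\<close> in \<open>exp (c x t) g(t)\<close>, as a polynomial in \<open>x\<close>.\<close>

definition appell :: "real \<Rightarrow> (nat \<Rightarrow> real) \<Rightarrow> nat \<Rightarrow> real poly" where
  "appell c g = fps_nth (Abs_fps (\<lambda>i. monom (c ^ i / fact i) i) * Abs_fps (\<lambda>j. [:g j:]))"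

lemma appell_0: "appell c g 0 = [:g 0:]"
  by (simp add: appell_def)

lemma coeff_appell: "coeff (appell c g n) i = (if i \<le> n then g (n - i) * c ^ i / fact i else 0)"
proof -
  have "coeff (appell c g n) i = (\<Sum>k=0..n. if k = i then g (n - k) * c ^ k / fact k else 0)"
    unfolding appell_def fps_mult_nth coeff_sum
    by (rule sum.cong) (auto simp: mult.commute[of "monom _ _"])
  then show ?thesis by simp
qed

text \<open>With \<open>g\<close> the coefficients of \<open>exp (- \<Sum>\<^sub>k \<sigma>\<^sub>k t\<^sup>k / k)\<close>, the recurrence is the coefficientwise
  form of the differential equation for \<open>exp (c x t) g(t)\<close>.\<close>

lemma appell_recurrence:
  assumes newton: "\<And>j. real j * g j = - (\<Sum>i=1..j. \<sigma> i * g (j - i))"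
  shows "[:0, c:] * appell c g i =
    Polynomial.smult (real (Suc i)) (appell c g (Suc i)) + (\<Sum>j\<le>i. Polynomial.smult (\<sigma> (Suc i - j)) (appell c g j))"
proof -
  define E :: "real poly fps" where "E = Abs_fps (\<lambda>i. monom (c ^ i / fact i) i)"
  define H :: "real poly fps" where "H = Abs_fps (\<lambda>j. [:g j:])"
  define S :: "real poly fps" where "S = Abs_fps (\<lambda>k. [:\<sigma> (Suc k):])"
  have E: "fps_deriv E = fps_const [:0, c:] * E"
  proof (rule fps_ext)
    fix n
    have "of_nat (Suc n) * monom (c ^ Suc n / fact (Suc n)) (Suc n) = monom (c ^ Suc n / fact n) (Suc n)"
    proof -
      have "real (Suc n) * (c ^ Suc n / fact (Suc n)) = c ^ Suc n / fact n"
        by (simp del: of_nat_Suc power_Suc)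
      then show ?thesis
        by (simp add: of_nat_poly smult_monom del: of_nat_Suc fact_Suc power_Suc)
    qed
    also have "\<dots> = [:0, c:] * monom (c ^ n / fact n) n"
      by (simp add: monom_Suc smult_monom)
    finally show "fps_nth (fps_deriv E) n = fps_nth (fps_const [:0, c:] * E) n"
      by (simp add: E_def del: of_nat_Suc fact_Suc)
  qed
  have H: "fps_deriv H = - (S * H)"
  proof (rule fps_ext)
    fix n
    have "fps_nth (S * H) n = (\<Sum>i=0..n. [:\<sigma> (Suc i) * g (n - i):])"
      unfolding fps_mult_nth by (rule sum.cong) (simp_all add: S_def H_def mult.commute)
    also have "\<dots> = [:\<Sum>i=0..n. \<sigma> (Suc i) * g (n - i):]"
      by (rule poly_eqI) (simp add: coeff_sum coeff_pCons split: nat.splits)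
    also have "(\<Sum>i=0..n. \<sigma> (Suc i) * g (n - i)) = (\<Sum>i=1..Suc n. \<sigma> i * g (Suc n - i))"
      unfolding One_nat_def sum.shift_bounds_cl_Suc_ivl by simp
    finally show "fps_nth (fps_deriv H) n = fps_nth (- (S * H)) n"
      using newton[of "Suc n"] by (simp add: H_def of_nat_poly mult.commute[of "g _"] del: of_nat_Suc)
  qed
  have F: "fps_nth (E * H) = appell c g" by (simp add: appell_def E_def H_def)
  have "fps_deriv (E * H) = fps_const [:0, c:] * (E * H) - S * (E * H)"
    by (simp add: E H algebra_simps)
  then have "fps_nth (fps_deriv (E * H)) i = [:0, c:] * appell c g i - fps_nth (S * (E * H)) i"
    by (metis F fps_sub_nth fps_mult_left_const_nth)
  moreover have "fps_nth (fps_deriv (E * H)) i = Polynomial.smult (real (Suc i)) (appell c g (Suc i))"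
    by (simp only: fps_deriv_nth F) (simp add: of_nat_poly del: of_nat_Suc)
  moreover have "fps_nth (S * (E * H)) i = (\<Sum>j\<le>i. Polynomial.smult (\<sigma> (Suc i - j)) (appell c g j))"
    unfolding fps_mult_nth[of S] F
    by (rule sum.reindex_bij_witness[of _ "\<lambda>j. i - j" "\<lambda>k. i - k"]) (auto simp: S_def)
  ultimately show ?thesis by (simp add: algebra_simps)
qed

text \<open>Up to the factor 1/N, the matrix of the classical determinant formula that expresses
  elementary symmetric functions by power sums. Its entries are non-negative exactly because the
  power sums are positive.\<close>

definition hess_mat :: "nat \<Rightarrow> (nat \<Rightarrow> real) \<Rightarrow> real mat" where
  "hess_mat N \<sigma> = mat N N (\<lambda>(i,j). if j \<le> i then \<sigma> (Suc i - j) / N else if j = Suc i then Suc i / N else 0)"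

text \<open>The Appell polynomials form an eigenvector up to the last row; using it as the first column
  of a unitriangular matrix reduces the characteristic polynomial to a triangular minor.\<close>

lemma char_poly_hess_mat:
  assumes newton: "\<And>j. real j * g j = - (\<Sum>i=1..j. \<sigma> i * g (j - i))" and g0: "g 0 = 1" and N: "N > 0"
  shows "char_poly (hess_mat N \<sigma>) = Polynomial.smult (fact N / real N ^ N) (appell (real N) g N)"
proof -
  let ?b = "appell (real N) g"
  define C where "C = char_poly_matrix (hess_mat N \<sigma>)"
  define U where "U = mat N N (\<lambda>(i,j). if j = 0 then ?b i else if i = j then 1 else 0)"
  have C: "C \<in> carrier_mat N N" by (simp add: C_def hess_mat_def)
  have U: "U \<in> carrier_mat N N" by (simp add: U_def)
  have CU: "C * U \<in> carrier_mat N N" using C U by simp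
  have Cij: "C $$ (i,j) = (if i = j then [:0,1:] else 0) - [:hess_mat N \<sigma> $$ (i,j):]" if "i < N" "j < N" for i j
    using that by (simp add: C_def char_poly_matrix_def hess_mat_def)
  have "det U = prod_list (diag_mat U)"
    by (rule det_lower_triangular[OF _ U]) (auto simp: U_def)
  also have "diag_mat U = map (\<lambda>_. 1) [0..<N]"
    unfolding diag_mat_def using U by (intro map_cong) (auto simp: U_def appell_0 g0 one_pCons)
  also have "prod_list \<dots> = 1" by (induction N) auto
  finally have detU: "det U = 1" .
  \<comment> \<open>Each row reproduces the recurrence. In the last one the superdiagonal entry
    falls outside the matrix; its weight would be N/N = 1, so \<open>?b N\<close> itself
    remains.\<close>
  have col0: "(C * U) $$ (i,0) = (if Suc i = N then ?b N else 0)" if i: "i < N" for i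
  proof -
    have "(C * U) $$ (i,0) = (\<Sum>j<N. C $$ (i,j) * ?b j)"
      unfolding mult_mat_index[OF C U i N] by (rule sum.cong) (auto simp: U_def N)
    also have "\<dots> = (\<Sum>j<N. (if i = j then [:0,1:] * ?b j else 0) - Polynomial.smult (hess_mat N \<sigma> $$ (i,j)) (?b j))"
      by (rule sum.cong) (use i in \<open>auto simp: Cij left_diff_distrib\<close>)
    also have "\<dots> = [:0,1:] * ?b i - (\<Sum>j<N. Polynomial.smult (hess_mat N \<sigma> $$ (i,j)) (?b j))"
      using i by (simp add: sum_subtractf)
    also have "[:0,1:] * ?b i = Polynomial.smult (1 / N) ([:0, real N:] * ?b i)"
      using N by simp
    also have "\<dots> = Polynomial.smult (Suc i / N) (?b (Suc i)) + (\<Sum>j\<le>i. Polynomial.smult (\<sigma> (Suc i - j) / N) (?b j))"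
      unfolding appell_recurrence[OF newton] by (simp add: smult_add_right smult_sum2)
    also have "(\<Sum>j<N. Polynomial.smult (hess_mat N \<sigma> $$ (i,j)) (?b j))
        = (\<Sum>j\<in>{..i}. Polynomial.smult (\<sigma> (Suc i - j) / N) (?b j))
          + (if Suc i = N then 0 else Polynomial.smult (Suc i / N) (?b (Suc i)))"
    proof -
      have "(\<Sum>j<N. Polynomial.smult (hess_mat N \<sigma> $$ (i,j)) (?b j))
          = (\<Sum>j<N. (if j \<le> i then Polynomial.smult (\<sigma> (Suc i - j) / N) (?b j) else 0)
              + (if j = Suc i then Polynomial.smult (Suc i / N) (?b (Suc i)) else 0))"
        by (rule sum.cong) (use i in \<open>auto simp: hess_mat_def\<close>)
      also have "\<dots> = (\<Sum>j<N. if j \<le> i then Polynomial.smult (\<sigma> (Suc i - j) / N) (?b j) else 0)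
          + (if Suc i < N then Polynomial.smult (Suc i / N) (?b (Suc i)) else 0)"
        by (simp add: sum.distrib)
      also have "(\<Sum>j<N. if j \<le> i then Polynomial.smult (\<sigma> (Suc i - j) / N) (?b j) else 0)
          = (\<Sum>j\<in>{..i}. Polynomial.smult (\<sigma> (Suc i - j) / N) (?b j))"
        using i by (intro sum.mono_neutral_cong_right) auto
      finally show ?thesis using i by auto
    qed
    finally show ?thesis using N by auto
  qed
  have col: "(C * U) $$ (i,j) = C $$ (i,j)" if ij: "i < N" "j < N" "j \<noteq> 0" for i j
  proof -
    have "(C * U) $$ (i,j) = (\<Sum>k<N. if k = j then C $$ (i,k) else 0)"
      unfolding mult_mat_index[OF C U ij(1,2)] by (rule sum.cong) (use ij in \<open>auto simp: U_def\<close>)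
    then show ?thesis using ij by simp
  qed
  define W where "W = C * U"
  obtain m where m: "N = Suc m" using N gr0_conv_Suc by blast
  \<comment> \<open>Deleting the last row and first column moves the superdiagonal onto the
    diagonal. The sign of its \<open>m\<close> negative entries cancels the sign of the
    cofactor.\<close>
  let ?D = "mat_delete W m 0"
  have W: "W \<in> carrier_mat N N" using CU by (simp add: W_def)
  have D: "?D \<in> carrier_mat m m" using mat_delete_carrier[OF W] m by simp
  have Dij: "?D $$ (i,j) = C $$ (i, Suc j)" if ij: "i < m" "j < m" for i j
  proof -
    have "?D $$ (i,j) = W $$ (i, Suc j)"
      using ij W m by (auto simp: mat_delete_def)
    also have "\<dots> = C $$ (i, Suc j)"
      unfolding W_def by (rule col) (use ij m in auto)
    finally show ?thesis .
  qed
  have "det ?D = prod_list (diag_mat ?D)"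
    by (rule det_lower_triangular[OF _ D]) (use m in \<open>auto simp: Dij Cij hess_mat_def\<close>)
  also have "diag_mat ?D = map (\<lambda>i. [:- (Suc i / N):]) [0..<m]"
    unfolding diag_mat_def using D by (intro map_cong) (use m in \<open>auto simp: Dij Cij hess_mat_def\<close>)
  also have "prod_list \<dots> = [:(-1) ^ m * (fact m / real N ^ m):]"
  proof -
    have "(\<Prod>i\<leftarrow>[0..<k]. [:- (Suc i / N):]) = [:(-1) ^ k * (fact k / real N ^ k):]" for k
      by (induction k) (simp_all add: one_pCons mult_ac del: of_nat_Suc)
    then show ?thesis .
  qed
  finally have detD: "det ?D = [:(-1) ^ m * (fact m / real N ^ m):]" .
  have "char_poly (hess_mat N \<sigma>) = det C" by (simp add: char_poly_def C_def)
  also have "\<dots> = det W" using det_mult[OF C U] detU by (simp add: W_def)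
  also have "\<dots> = (\<Sum>i<N. W $$ (i,0) * cofactor W i 0)"
    by (rule laplace_expansion_column[OF W N])
  also have "\<dots> = (\<Sum>i<N. if i = m then ?b N * cofactor W i 0 else 0)"
    by (rule sum.cong) (use m in \<open>auto simp: W_def col0 simp del: index_mult_mat\<close>)
  also have "\<dots> = ?b N * ((-1) ^ m * det ?D)"
    using m by (simp add: cofactor_def)
  also have "(-1) ^ m * det ?D = [:fact m / real N ^ m:]"
  proof -
    have "(-1 :: real poly) ^ n = [:(-1) ^ n:]" for n
      by (induction n) (simp_all add: one_pCons)
    moreover have "(-1 :: real) ^ n * ((-1) ^ n * x) = x" for n x
      by (simp flip: mult.assoc power_mult_distrib)
    ultimately show ?thesis unfolding detD by simp
  qed
  also have "fact m / real N ^ m = fact N / real N ^ N"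
    unfolding m by (simp add: field_simps del: of_nat_Suc)
  finally show ?thesis by (simp add: mult.commute)
qed

lemma coeff_char_poly_hess_mat:
  assumes "\<And>j. real j * g j = - (\<Sum>i=1..j. \<sigma> i * g (j - i))" "g 0 = 1" "N > 0" "i \<le> N"
  shows "coeff (char_poly (hess_mat N \<sigma>)) i = g (N - i) * (fact N / (fact i * real N ^ (N - i)))"
proof -
  have "real N ^ N = real N ^ i * real N ^ (N - i)"
    using assms(4) by (simp flip: power_add)
  then show ?thesis
    unfolding char_poly_hess_mat[OF assms(1-3)] using assms(3,4) by (simp add: coeff_appell mult_ac)
qed

subsection \<open>Positive matrices\<close>

definition row_shear :: "nat \<Rightarrow> nat \<Rightarrow> real \<Rightarrow> real mat" where
  "row_shear N r e = mat N N (\<lambda>(i,j). if i = j then 1 else if i = r \<and> r < j then e else 0)"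

lemma row_shear_carrier [simp]: "row_shear N r e \<in> carrier_mat N N"
  by (simp add: row_shear_def)

lemma row_shear_mult:
  assumes B: "B \<in> carrier_mat N N" and ij: "i < N" "j < N"
  shows "(row_shear N r e * B) $$ (i,j) = B $$ (i,j) + (if i = r then e * (\<Sum>c\<in>{r<..<N}. B $$ (c,j)) else 0)"
proof -
  have "(row_shear N r e * B) $$ (i,j)
      = (\<Sum>k<N. (if i = k then B $$ (k,j) else 0) + (if k \<in> {r<..<N} then (if i = r then e * B $$ (k,j) else 0) else 0))"
    unfolding mult_mat_index[OF row_shear_carrier B ij]
    by (rule sum.cong) (use ij in \<open>auto simp: row_shear_def\<close>)
  also have "\<dots> = B $$ (i,j) + (\<Sum>k<N. if k \<in> {r<..<N} then (if i = r then e * B $$ (k,j) else 0) else 0)"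
    using ij by (simp add: sum.distrib)
  also have "(\<Sum>k<N. if k \<in> {r<..<N} then (if i = r then e * B $$ (k,j) else 0) else 0)
      = (\<Sum>k\<in>{r<..<N}. if i = r then e * B $$ (k,j) else 0)"
    by (intro sum.mono_neutral_cong_right) auto
  finally show ?thesis by (simp add: sum_distrib_left)
qed

lemma mult_row_shear:
  assumes B: "B \<in> carrier_mat N N" and ij: "i < N" "j < N" and r: "r < N"
  shows "(B * row_shear N r e) $$ (i,j) = B $$ (i,j) + (if r < j then e * B $$ (i,r) else 0)"
proof -
  have "(B * row_shear N r e) $$ (i,j)
      = (\<Sum>k<N. (if k = j then B $$ (i,k) else 0) + (if k = r then (if r < j then e * B $$ (i,k) else 0) else 0))"
    unfolding mult_mat_index[OF B row_shear_carrier ij]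
    by (rule sum.cong) (use ij in \<open>auto simp: row_shear_def\<close>)
  then show ?thesis using ij r by (simp add: sum.distrib)
qed

lemma row_shear_inverse:
  assumes r: "r < N"
  shows "row_shear N r e * row_shear N r (-e) = 1\<^sub>m N"
proof (rule eq_matI)
  fix i j assume "i < dim_row (1\<^sub>m N :: real mat)" "j < dim_col (1\<^sub>m N :: real mat)"
  then have ij: "i < N" "j < N" by auto
  show "(row_shear N r e * row_shear N r (-e)) $$ (i,j) = 1\<^sub>m N $$ (i,j)"
    unfolding mult_row_shear[OF row_shear_carrier ij r]
    using ij r by (auto simp: row_shear_def)
qed (simp_all add: row_shear_def)

text \<open>With s = r + 1, the conjugation adds e times column s to all later columns, which makes
  row r positive since its superdiagonal entry is. The inverse shear subtracts only from row s,
  which is already positive and stays so for small e > 0.\<close>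

lemma make_row_positive:
  fixes A :: "real mat"
  assumes A: "A \<in> carrier_mat N N" and r: "Suc r < N"
    and nn: "\<And>i j. i < N \<Longrightarrow> j < N \<Longrightarrow> 0 \<le> A $$ (i,j)"
    and hess: "\<And>i j. i < N \<Longrightarrow> j < N \<Longrightarrow> j \<le> Suc i \<Longrightarrow> 0 < A $$ (i,j)"
    and rows: "\<And>i j. Suc r \<le> i \<Longrightarrow> i < N \<Longrightarrow> j < N \<Longrightarrow> 0 < A $$ (i,j)"
  obtains A' where "A' \<in> carrier_mat N N" "similar_mat A' A"
    "\<And>i j. i < N \<Longrightarrow> j < N \<Longrightarrow> 0 \<le> A' $$ (i,j)"
    "\<And>i j. i < N \<Longrightarrow> j < N \<Longrightarrow> j \<le> Suc i \<Longrightarrow> 0 < A' $$ (i,j)"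
    "\<And>i j. r \<le> i \<Longrightarrow> i < N \<Longrightarrow> j < N \<Longrightarrow> 0 < A' $$ (i,j)"
proof -
  let ?s = "Suc r"
  define B where "B e = row_shear N ?s (-e) * (A * row_shear N ?s e)" for e
  have AS: "A * row_shear N ?s e \<in> carrier_mat N N" for e
    using A row_shear_carrier by (rule mult_carrier_mat)
  have B_carrier: "B e \<in> carrier_mat N N" for e
    unfolding B_def using row_shear_carrier AS by (rule mult_carrier_mat)
  have B: "B e $$ (i,j) = A $$ (i,j) + (if ?s < j then e * A $$ (i,?s) else 0)
      - (if i = ?s then e * (\<Sum>c\<in>{?s<..<N}. A $$ (c,j) + (if ?s < j then e * A $$ (c,?s) else 0)) else 0)"
    if ij: "i < N" "j < N" for i j e
  proof -
    have "(\<Sum>c\<in>{?s<..<N}. (A * row_shear N ?s e) $$ (c,j))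
        = (\<Sum>c\<in>{?s<..<N}. A $$ (c,j) + (if ?s < j then e * A $$ (c,?s) else 0))"
      by (rule sum.cong) (use ij r in \<open>auto simp: mult_row_shear[OF A]\<close>)
    then show ?thesis
      unfolding B_def row_shear_mult[OF AS ij] mult_row_shear[OF A ij r] by simp
  qed
  have "\<forall>\<^sub>F e in at_right 0. \<forall>j\<in>{..<N}. 0 < B e $$ (?s,j)"
  proof (rule eventually_ball_finite)
    show "\<forall>j\<in>{..<N}. \<forall>\<^sub>F e in at_right 0. 0 < B e $$ (?s,j)"
    proof
      fix j assume j: "j \<in> {..<N}"
      let ?rhs = "\<lambda>e. A $$ (?s,j) + (if ?s < j then e * A $$ (?s,?s) else 0)
          - e * (\<Sum>c\<in>{?s<..<N}. A $$ (c,j) + (if ?s < j then e * A $$ (c,?s) else 0))"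
      have "(?rhs \<longlongrightarrow> A $$ (?s,j)) (at_right 0)"
        by (cases "?s < j") (auto intro!: tendsto_eq_intros)
      then have "\<forall>\<^sub>F e in at_right 0. 0 < ?rhs e"
        using rows[of ?s j] j r by (intro order_tendstoD) auto
      then show "\<forall>\<^sub>F e in at_right 0. 0 < B e $$ (?s,j)"
        using j r by (simp add: B)
    qed
  qed simp
  moreover have "\<forall>\<^sub>F e in at_right (0::real). 0 < e"
    by (rule eventually_at_right_less)
  ultimately have "\<forall>\<^sub>F e in at_right 0. (\<forall>j\<in>{..<N}. 0 < B e $$ (?s,j)) \<and> 0 < e"
    by (rule eventually_conj)
  then have "\<exists>e. (\<forall>j\<in>{..<N}. 0 < B e $$ (?s,j)) \<and> 0 < e"
    by (rule eventually_happens'[rotated]) (rule trivial_limit_at_right_real)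
  then obtain e where e: "\<And>j. j < N \<Longrightarrow> 0 < B e $$ (?s,j)" "0 < e"
    by auto
  have ge: "A $$ (i,j) + (if ?s < j then e * A $$ (i,?s) else 0) = B e $$ (i,j)" if "i < N" "j < N" "i \<noteq> ?s" for i j
    using that by (simp add: B)
  have extra: "0 \<le> (if ?s < j then e * A $$ (i,?s) else 0)" if "i < N" for i j
    using nn[OF that r] e by simp
  have "similar_mat (B e) A"
  proof (rule similar_matI[of _ _ "row_shear N ?s (-e)" "row_shear N ?s e" N])
    show "B e = row_shear N ?s (-e) * A * row_shear N ?s e"
      unfolding B_def using A by (simp add: assoc_mult_mat[of _ N N _ N _ N])
  qed (use A B_carrier row_shear_inverse[OF r, of e] row_shear_inverse[OF r, of "-e"] in auto)
  moreover have "0 \<le> B e $$ (i,j)" if "i < N" "j < N" for i j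
    using ge[OF that] nn[OF that] extra[OF that(1), of j] e(1)[OF that(2)] by (cases "i = ?s") auto
  moreover have "0 < B e $$ (i,j)" if "i < N" "j < N" "j \<le> Suc i" for i j
    using ge[OF that(1,2)] hess[OF that] extra[OF that(1), of j] e(1)[OF that(2)] by (cases "i = ?s") auto
  moreover have "0 < B e $$ (i,j)" if i: "r \<le> i" "i < N" "j < N" for i j
  proof (cases "i = r \<and> ?s < j")
    case True
    then have "0 < e * A $$ (i,?s)" using hess[of r ?s] r e by simp
    then show ?thesis using ge[of i j] nn[of i j] i True by auto
  next
    case False
    show ?thesis
    proof (cases "i = r")
      case True
      then show ?thesis using False calculation(3)[of i j] i by simp
    next
      case False
      then show ?thesis
        using rows[of i j] ge[of i j] extra[of i j] e(1)[of j] i by (cases "i = ?s") auto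
    qed
  qed
  ultimately show thesis using that B_carrier by blast
qed

text \<open>Rows are treated from the bottom upwards: the last row lies entirely in the positive
  Hessenberg part, and each treated row supplies the slack for the one above it.\<close>

lemma similar_to_positive:
  fixes A :: "real mat"
  assumes A: "A \<in> carrier_mat N N"
    and nn: "\<And>i j. i < N \<Longrightarrow> j < N \<Longrightarrow> 0 \<le> A $$ (i,j)"
    and hess: "\<And>i j. i < N \<Longrightarrow> j < N \<Longrightarrow> j \<le> Suc i \<Longrightarrow> 0 < A $$ (i,j)"
  obtains B where "B \<in> carrier_mat N N" "similar_mat B A" "\<And>i j. i < N \<Longrightarrow> j < N \<Longrightarrow> 0 < B $$ (i,j)"
proof -
  define Q where "Q m B \<longleftrightarrow> B \<in> carrier_mat N N \<and> similar_mat B A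
      \<and> (\<forall>i<N. \<forall>j<N. 0 \<le> B $$ (i,j)) \<and> (\<forall>i<N. \<forall>j<N. j \<le> Suc i \<longrightarrow> 0 < B $$ (i,j))
      \<and> (\<forall>i<N. \<forall>j<N. m \<le> i \<longrightarrow> 0 < B $$ (i,j))" for m B
  have "\<exists>B. Q (N - 1 - k) B" for k
  proof (induction k)
    case 0
    have "Q (N - 1 - 0) A"
      unfolding Q_def using A nn hess similar_mat_refl[OF A] by simp
    then show ?case by blast
  next
    case (Suc k)
    then obtain B where Q: "Q (N - 1 - k) B" by blast
    show ?case
    proof (cases "k < N - 1")
      case True
      then have eq: "Suc (N - 1 - Suc k) = N - 1 - k" and lt: "Suc (N - 1 - Suc k) < N" by simp_all
      have B: "B \<in> carrier_mat N N" "similar_mat B A"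
        "\<And>i j. i < N \<Longrightarrow> j < N \<Longrightarrow> 0 \<le> B $$ (i,j)"
        "\<And>i j. i < N \<Longrightarrow> j < N \<Longrightarrow> j \<le> Suc i \<Longrightarrow> 0 < B $$ (i,j)"
        "\<And>i j. Suc (N - 1 - Suc k) \<le> i \<Longrightarrow> i < N \<Longrightarrow> j < N \<Longrightarrow> 0 < B $$ (i,j)"
        using Q unfolding Q_def eq by blast+
      show ?thesis
      proof (rule make_row_positive[OF B(1) lt B(3) B(4) B(5)])
        fix B' assume B': "B' \<in> carrier_mat N N" "similar_mat B' B"
          "\<And>i j. i < N \<Longrightarrow> j < N \<Longrightarrow> 0 \<le> B' $$ (i,j)"
          "\<And>i j. i < N \<Longrightarrow> j < N \<Longrightarrow> j \<le> Suc i \<Longrightarrow> 0 < B' $$ (i,j)"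
          "\<And>i j. N - 1 - Suc k \<le> i \<Longrightarrow> i < N \<Longrightarrow> j < N \<Longrightarrow> 0 < B' $$ (i,j)"
        have "similar_mat B' A" using B'(2) B(2) by (rule similar_mat_trans)
        then have "Q (N - 1 - Suc k) B'"
          unfolding Q_def using B' by blast
        then show ?thesis by blast
      qed
    next
      case False
      then have "N - 1 - Suc k = N - 1 - k" by simp
      then show ?thesis using Q by metis
    qed
  qed
  \<comment> \<open>Truncated subtraction gives \<open>N - 1 - N = 0\<close>, so every row is
    covered.\<close>
  from this[of N] obtain B where "Q (N - 1 - N) B" by blast
  then have "B \<in> carrier_mat N N" "similar_mat B A" "\<And>i j. i < N \<Longrightarrow> j < N \<Longrightarrow> 0 < B $$ (i,j)"
    unfolding Q_def by simp_all
  then show thesis by (rule that)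
qed

section \<open>Perron eigenvectors of positive matrices\<close>

lemma finite_pos_lower_bound:
  fixes f :: "'a \<Rightarrow> real"
  assumes "finite S" "\<And>x. x \<in> S \<Longrightarrow> f x > 0"
  obtains c where "c > 0" "\<And>x. x \<in> S \<Longrightarrow> c \<le> f x"
proof
  show "Min (insert 1 (f ` S)) > 0" using assms by (auto simp: Min_gr_iff)
  show "Min (insert 1 (f ` S)) \<le> f x" if "x \<in> S" for x
    using assms(1) that by (intro Min_le) auto
qed

text \<open>If \<open>A \<bar>u\<bar> \<noteq> \<bar>u\<bar>\<close>, then \<open>y = A \<bar>u\<bar>\<close> satisfies \<open>A y \<ge> (1 + \<delta>) y\<close>, so the traces of the powers grow exponentially.\<close>

lemma perron_eigenvector_abs:
  fixes A :: "real mat" and u :: "nat \<Rightarrow> real"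
  assumes A: "A \<in> carrier_mat N N" and pos: "\<And>i j. i < N \<Longrightarrow> j < N \<Longrightarrow> 0 < A $$ (i,j)"
    and tr: "\<And>k. (\<Sum>i<N. (A ^\<^sub>m Suc k) $$ (i,i)) \<le> C"
    and eig: "\<And>i. i < N \<Longrightarrow> (\<Sum>j<N. A $$ (i,j) * u j) = u i" and nz: "j0 < N" "u j0 \<noteq> 0"
    and i: "i < N"
  shows "(\<Sum>j<N. A $$ (i,j) * \<bar>u j\<bar>) = \<bar>u i\<bar>" "\<bar>u i\<bar> > 0"
proof -
  define y where "y i = (\<Sum>j<N. A $$ (i,j) * \<bar>u j\<bar>)" for i
  have y_pos: "y i > 0" if "i < N" for i
    unfolding y_def using that nz pos less_imp_le[OF pos]
    by (intro sum_pos2[of _ j0]) auto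
  have uy: "\<bar>u i\<bar> \<le> y i" if "i < N" for i
  proof -
    have "\<bar>u i\<bar> \<le> (\<Sum>j<N. \<bar>A $$ (i,j) * u j\<bar>)"
      unfolding eig[OF that, symmetric] by (rule sum_abs)
    also have "\<dots> = y i"
      unfolding y_def using that pos by (intro sum.cong) (auto simp: abs_mult less_imp_le)
    finally show ?thesis .
  qed
  have "y i = \<bar>u i\<bar>" if i: "i < N" for i
  proof (rule ccontr)
    assume ne: "y i \<noteq> \<bar>u i\<bar>"
    \<comment> \<open>One strict inequality at \<open>i\<close> is spread to all rows by the
      positivity of \<open>A\<close>; finiteness then yields a common factor
      \<open>1 + \<delta>\<close>.\<close>
    have grow: "(\<Sum>l<N. A $$ (j,l) * y l) - y j > 0" if j: "j < N" for j
    proof -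
      have "(\<Sum>l<N. A $$ (j,l) * y l) - y j = (\<Sum>l<N. A $$ (j,l) * (y l - \<bar>u l\<bar>))"
        unfolding y_def[of j] by (simp add: sum_subtractf right_diff_distrib)
      also have "\<dots> > 0"
        using i j ne uy pos less_imp_le[OF pos] order.not_eq_order_implies_strict[OF _ uy[OF i]]
        by (intro sum_pos2[of _ i]) auto
      finally show ?thesis .
    qed
    obtain \<delta> where \<delta>: "\<delta> > 0" "\<And>j. j < N \<Longrightarrow> \<delta> \<le> ((\<Sum>l<N. A $$ (j,l) * y l) - y j) / y j"
      using finite_pos_lower_bound[of "{..<N}" "\<lambda>j. ((\<Sum>l<N. A $$ (j,l) * y l) - y j) / y j"] grow y_pos by auto
    have step: "(1 + \<delta>) * y j \<le> (\<Sum>l<N. A $$ (j,l) * y l)" if "j < N" for j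
      using \<delta>(2)[OF that] y_pos[OF that] by (simp add: field_simps)
    \<comment> \<open>\<open>\<eta>\<close> compares \<open>y\<close> with the columns of
      \<open>A\<close>, which turns growth of \<open>A ^ k y\<close> into growth of a diagonal entry
      of the next power, and so of a trace.\<close>
    obtain \<eta> where \<eta>: "\<eta> > 0" "\<And>j l. j < N \<Longrightarrow> l < N \<Longrightarrow> \<eta> \<le> A $$ (j,l) / y j"
    proof (rule finite_pos_lower_bound[of "{..<N} \<times> {..<N}" "\<lambda>(j,l). A $$ (j,l) / y j"])
      fix c assume "c > 0" "\<And>x. x \<in> {..<N} \<times> {..<N} \<Longrightarrow> c \<le> (case x of (j,l) \<Rightarrow> A $$ (j,l) / y j)"
      then show thesis using that[of c] by force
    qed (use pos y_pos in auto)
    have Ak: "A ^\<^sub>m k \<in> carrier_mat N N" for k using A by simp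
    have nn: "0 \<le> (A ^\<^sub>m k) $$ (i,j)" if "i < N" "j < N" for i j k
      using that
    proof (induction k arbitrary: i j)
      case (Suc k)
      then show ?case
        using less_imp_le[OF pos]
        by (simp add: mult_mat_index[OF Ak A]) (intro sum_nonneg mult_nonneg_nonneg, auto)
    qed (use A in auto)
    have growth: "(1 + \<delta>) ^ k * y i \<le> (\<Sum>j<N. (A ^\<^sub>m k) $$ (i,j) * y j)" if "i < N" for i k
    proof (induction k)
      case 0
      then show ?case using A that by (simp add: if_distrib[of "\<lambda>x. x * _"] cong: if_cong)
    next
      case (Suc k)
      have "(1 + \<delta>) ^ Suc k * y i = (1 + \<delta>) * ((1 + \<delta>) ^ k * y i)" by simp
      also have "\<dots> \<le> (1 + \<delta>) * (\<Sum>j<N. (A ^\<^sub>m k) $$ (i,j) * y j)"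
        using Suc \<delta> by (intro mult_left_mono) auto
      also have "\<dots> = (\<Sum>j<N. (A ^\<^sub>m k) $$ (i,j) * ((1 + \<delta>) * y j))"
        by (simp add: sum_distrib_left mult_ac)
      also have "\<dots> \<le> (\<Sum>j<N. (A ^\<^sub>m k) $$ (i,j) * (\<Sum>l<N. A $$ (j,l) * y l))"
        using step nn that by (intro sum_mono mult_left_mono) auto
      also have "\<dots> = (\<Sum>j<N. \<Sum>l<N. (A ^\<^sub>m k) $$ (i,j) * A $$ (j,l) * y l)"
        by (simp add: sum_distrib_left mult.assoc)
      also have "\<dots> = (\<Sum>l<N. \<Sum>j<N. (A ^\<^sub>m k) $$ (i,j) * A $$ (j,l) * y l)"
        by (rule sum.swap)
      also have "\<dots> = (\<Sum>l<N. (A ^\<^sub>m Suc k) $$ (i,l) * y l)"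
        using that by (simp add: mult_mat_index[OF Ak A] sum_distrib_right)
      finally show ?case .
    qed
    have bound: "\<eta> * ((1 + \<delta>) ^ k * y i) \<le> C" for k
    proof -
      have "\<eta> * ((1 + \<delta>) ^ k * y i) \<le> \<eta> * (\<Sum>j<N. (A ^\<^sub>m k) $$ (i,j) * y j)"
        using growth[OF i] \<eta> by (intro mult_left_mono) auto
      also have "\<dots> = (\<Sum>j<N. (A ^\<^sub>m k) $$ (i,j) * (\<eta> * y j))"
        by (simp add: sum_distrib_left mult_ac)
      also have "\<dots> \<le> (\<Sum>j<N. (A ^\<^sub>m k) $$ (i,j) * A $$ (j,i))"
        using nn i \<eta>(2) y_pos by (intro sum_mono mult_left_mono) (auto simp: pos_le_divide_eq)
      also have "\<dots> = (A ^\<^sub>m Suc k) $$ (i,i)"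
        using i by (simp add: mult_mat_index[OF Ak A])
      also have "\<dots> \<le> (\<Sum>i<N. (A ^\<^sub>m Suc k) $$ (i,i))"
        using i nn by (intro member_le_sum) (auto simp del: pow_mat.simps)
      finally show ?thesis using tr[of k] by linarith
    qed
    obtain k where "C / (\<eta> * y i) < (1 + \<delta>) ^ k"
      using real_arch_pow[of "1 + \<delta>"] \<delta> by auto
    then show False
      using bound[of k] \<eta> y_pos[OF i] by (simp add: field_simps)
  qed
  then show "(\<Sum>j<N. A $$ (i,j) * \<bar>u j\<bar>) = \<bar>u i\<bar>" "\<bar>u i\<bar> > 0"
    using i y_pos[OF i] unfolding y_def by auto
qed

section \<open>Reversed polynomials and the perturbation factor\<close>

lemma reflect_prod_linear_factors:
  "reflect_poly (\<Prod>z\<leftarrow>zs. [:-z, 1:]) = recip_poly (mset zs)"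
proof (induction zs)
  case (Cons z zs)
  have "reflect_poly [:-z, 1:] = [:1, -z:]"
    by (cases "z = 0") (simp_all add: reflect_poly_def cCons_def)
  then show ?case
    using Cons by (simp add: reflect_poly_mult del: mult_pCons_left)
qed simp

text \<open>\<open>P\<close> equals x^(N - n) times the product of the factors x - z, so a matrix
  larger than \<open>E\<close> only gains zero eigenvalues.\<close>

lemma order_of_reversed_recip_poly:
  assumes coeffs: "\<And>i. i \<le> N \<Longrightarrow> coeff P i = coeff (recip_poly E) (N - i)"
    and deg: "degree P \<le> N" and size: "size E \<le> N" and x: "x \<noteq> 0"
  shows "Polynomial.order x P = count E x"
proof -
  obtain zs where zs: "mset zs = E" using ex_mset by blast
  define R where "R = (\<Prod>z\<leftarrow>zs. [:-z, 1:])"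
  define n where "n = size E"
  have degR: "degree R = n"
    unfolding R_def n_def using degree_linear_factors[of uminus zs] zs by auto
  have R: "coeff R k = coeff (recip_poly E) (n - k)" if "k \<le> n" for k
    using that unfolding zs[symmetric] reflect_prod_linear_factors[symmetric] R_def[symmetric]
    by (simp add: coeff_reflect_poly degR)
  have "P = monom 1 (N - n) * R"
  proof (rule poly_eqI)
    fix i
    consider "i > N" | "i < N - n" | "i \<le> N" "N - n \<le> i" by linarith
    then show "coeff P i = coeff (monom 1 (N - n) * R) i"
    proof cases
      case 1
      then show ?thesis using deg degR size by (simp add: coeff_monom_mult coeff_eq_0 n_def)
    next
      case 2
      then have "degree (recip_poly E) < N - i" using degree_recip_poly_le[of E] by (simp add: n_def)
      then show ?thesis using 2 by (simp add: coeff_monom_mult coeffs coeff_eq_0)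
    next
      case 3
      then have "n - (i - (N - n)) = N - i" using size by (simp add: n_def)
      then show ?thesis using 3 size R[of "i - (N - n)"] by (simp add: coeff_monom_mult coeffs n_def)
    qed
  qed
  moreover have "R \<noteq> 0" unfolding R_def by (induction zs) (simp_all del: mult_pCons_left)
  moreover have "Polynomial.order x (monom 1 (N - n)) = 0"
    using x by (intro order_0I) (simp add: poly_monom)
  ultimately have "Polynomial.order x P = Polynomial.order x R"
    by (simp add: order_mult monom_eq_0_iff)
  then show ?thesis
    unfolding R_def order_prod_linear_factors zs .
qed

text \<open>For \<open>j \<le> N\<close> this is N^j (N - j)! / N!, written so that the limit in N
  can be taken factor by factor.\<close>

definition falling_ratio :: "nat \<Rightarrow> nat \<Rightarrow> real" where
  "falling_ratio N j = (\<Prod>i<j. real N / (real N - real i))"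

lemma falling_ratio_tendsto: "(\<lambda>N. falling_ratio N j) \<longlonglongrightarrow> 1"
proof -
  have "(\<lambda>N. real N / (real N - real i)) \<longlonglongrightarrow> 1" for i
  proof -
    have "(\<lambda>N. 1 / (1 - real i / real N)) \<longlonglongrightarrow> 1 / (1 - 0)"
      by (intro tendsto_intros lim_const_over_n) auto
    moreover have "\<forall>\<^sub>F N in sequentially. 1 / (1 - real i / real N) = real N / (real N - real i)"
      using eventually_gt_at_top[of 0] by eventually_elim (simp add: field_simps)
    ultimately show ?thesis using Lim_transform_eventually by fastforce
  qed
  then have "(\<lambda>N. \<Prod>i<j. real N / (real N - real i)) \<longlonglongrightarrow> (\<Prod>i<j. 1)"
    by (intro tendsto_prod)
  then show ?thesis by (simp add: falling_ratio_def)
qed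

lemma falling_ratio_fact:
  assumes "j \<le> N"
  shows "falling_ratio N j * (fact N / (fact (N - j) * real N ^ j)) = 1"
proof -
  have fact: "fact N = fact (N - j) * (\<Prod>i<j. real N - real i)"
    using assms
  proof (induction j)
    case (Suc j)
    have "N - j = Suc (N - Suc j)" using Suc.prems by simp
    then have "fact (N - j) = (real N - real j) * fact (N - Suc j)"
      using Suc.prems by (simp add: of_nat_diff)
    then show ?case using Suc by simp
  qed simp
  have "(\<Prod>i<j. real N - real i) \<noteq> 0" using assms by auto
  moreover have "real N ^ j \<noteq> 0" using assms by (cases "j = 0") auto
  ultimately show ?thesis
    unfolding fact by (simp add: falling_ratio_def prod_dividef)
qed

text \<open>The perturbed coefficients \<open>p\<^sub>j N\<^sup>j (N - j)! / N!\<close> are chosen so that the matrix built from their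
  power sums has exactly the prescribed nonzero spectrum.\<close>

lemma exists_positive_matrix:
  fixes L :: "complex multiset"
  assumes L: "\<And>z. z \<in># L \<Longrightarrow> cmod z < 1"
    and ps: "\<And>k. k \<ge> 1 \<Longrightarrow> Im (power_sum k (add_mset 1 L)) = 0 \<and> Re (power_sum k (add_mset 1 L)) > 0"
  obtains N :: nat and A :: "real mat" where "A \<in> carrier_mat N N" "\<And>i j. i < N \<Longrightarrow> j < N \<Longrightarrow> 0 < A $$ (i,j)"
    "eigenvalue A 1" "\<And>x. x \<noteq> 0 \<Longrightarrow> Polynomial.order x (char_poly (map_mat complex_of_real A)) = count (add_mset 1 L) x"
proof -
  let ?E = "add_mset 1 L"
  define n where "n = size ?E"
  define p where "p = (\<lambda>j. coeff (recip_poly ?E) j)"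
  have p_real: "p j \<in> \<real>" for j
    unfolding p_def by (rule coeff_recip_poly_Reals) (use ps in \<open>simp add: complex_is_Real_iff\<close>)
  have p_zero: "p j = 0" if "n < j" for j
    unfolding p_def using degree_recip_poly_le[of ?E] that by (intro coeff_eq_0) (simp add: n_def)
  define G where "G N = (\<Sum>j\<le>n. monom (p j * of_real (falling_ratio N j)) j)" for N
  have coeff_G: "coeff (G N) j = p j * of_real (falling_ratio N j)" for N j
    by (cases "j \<le> n") (simp_all add: G_def coeff_sum p_zero)
  have "degree (G N) \<le> n" for N
    unfolding G_def by (intro degree_sum_le) (auto intro: order_trans[OF degree_monom_le])
  moreover have "poly (G N) 0 = 1" for N
    by (simp add: poly_0_coeff_0 coeff_G falling_ratio_def p_def del: recip_poly_simps)
  ultimately have "\<exists>A. G N = recip_poly A \<and> size A \<le> n" for N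
    using recip_poly_factorization by metis
  then obtain A where A: "\<And>N. G N = recip_poly (A N)" "\<And>N. size (A N) \<le> n"
    by metis
  have A_real: "coeff (recip_poly (A N)) j \<in> \<real>" for N j
    unfolding A(1)[symmetric] coeff_G using p_real by (intro Reals_mult) auto
  have A_lim: "(\<lambda>N. coeff (recip_poly (A N)) j) \<longlonglongrightarrow> coeff (recip_poly ?E) j" for j
  proof -
    have "(\<lambda>N. p j * of_real (falling_ratio N j)) \<longlonglongrightarrow> p j * of_real 1"
      by (intro tendsto_intros falling_ratio_tendsto)
    then show ?thesis unfolding A(1)[symmetric] coeff_G by (simp add: p_def del: recip_poly_simps)
  qed
  have "\<forall>\<^sub>F N in sequentially. \<forall>k\<ge>1. Re (power_sum k (A N)) > 0"
    by (rule power_sums_pos_of_perturbation[OF L ps[THEN conjunct2] A_real A_lim A(2)])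
  \<comment> \<open>The size \<open>N \<ge> n\<close> leaves room for all prescribed
    eigenvalues.\<close>
  then have "\<forall>\<^sub>F N in sequentially. (\<forall>k\<ge>1. Re (power_sum k (A N)) > 0) \<and> n \<le> N"
    using eventually_ge_at_top by (rule eventually_conj)
  then have "\<exists>N. (\<forall>k\<ge>1. Re (power_sum k (A N)) > 0) \<and> n \<le> N"
    by (rule eventually_happens'[rotated]) simp
  then obtain N where N: "\<And>k. k \<ge> 1 \<Longrightarrow> Re (power_sum k (A N)) > 0" "n \<le> N"
    by blast
  have N0: "N > 0" using N(2) by (simp add: n_def)
  define \<sigma> where "\<sigma> k = Re (power_sum k (A N))" for k
  define g where "g j = Re (coeff (recip_poly (A N)) j)" for j
  have g: "of_real (g j) = coeff (recip_poly (A N)) j" for j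
    using A_real by (simp add: g_def of_real_Re)
  have \<sigma>: "of_real (\<sigma> k) = power_sum k (A N)" if "k \<ge> 1" for k
    using power_sum_Reals[OF A_real that] by (simp add: \<sigma>_def of_real_Re)
  have newton: "real j * g j = - (\<Sum>i=1..j. \<sigma> i * g (j - i))" for j
  proof -
    have "complex_of_real (real j * g j) = - (\<Sum>i=1..j. power_sum i (A N) * coeff (recip_poly (A N)) (j - i))"
      using newton_identity[of j "A N"] by (simp add: g)
    also have "\<dots> = of_real (- (\<Sum>i=1..j. \<sigma> i * g (j - i)))"
      by (simp add: g \<sigma>)
    finally show ?thesis by (simp only: of_real_eq_iff)
  qed
  have g0: "g 0 = 1" by (simp add: g_def)
  have H: "hess_mat N \<sigma> \<in> carrier_mat N N" by (simp add: hess_mat_def)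
  have \<sigma>_pos: "\<sigma> k > 0" if "k \<ge> 1" for k using N(1)[OF that] by (simp add: \<sigma>_def)
  have H_nonneg: "0 \<le> hess_mat N \<sigma> $$ (i,j)" if "i < N" "j < N" for i j
    using that \<sigma>_pos[of "Suc i - j"] N0 by (auto simp: hess_mat_def less_imp_le)
  have H_pos: "0 < hess_mat N \<sigma> $$ (i,j)" if "i < N" "j < N" "j \<le> Suc i" for i j
    using that \<sigma>_pos[of "Suc i - j"] N0 by (cases "j = Suc i") (auto simp: hess_mat_def)
  obtain B where B: "B \<in> carrier_mat N N" "similar_mat B (hess_mat N \<sigma>)" "\<And>i j. i < N \<Longrightarrow> j < N \<Longrightarrow> 0 < B $$ (i,j)"
    using similar_to_positive[OF H H_nonneg H_pos] by blast
  define P where "P = char_poly (map_mat complex_of_real B)"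
  have P: "P = map_poly complex_of_real (char_poly (hess_mat N \<sigma>))"
    unfolding P_def of_real_hom.char_poly_hom[OF B(1)] char_poly_similar[OF B(2)] ..
  have order_P: "Polynomial.order x P = count ?E x" if "x \<noteq> 0" for x
  proof (rule order_of_reversed_recip_poly[OF _ _ _ that])
    show "coeff P i = coeff (recip_poly ?E) (N - i)" if i: "i \<le> N" for i
    proof -
      have "coeff P i = coeff (recip_poly (A N)) (N - i) * of_real (fact N / (fact i * real N ^ (N - i)))"
        unfolding P by (simp add: coeff_map_poly coeff_char_poly_hess_mat[OF newton g0 N0 i] flip: g)
      also have "\<dots> = p (N - i) * of_real (falling_ratio N (N - i) * (fact N / (fact (N - (N - i)) * real N ^ (N - i))))"
        unfolding A(1)[symmetric] coeff_G using i by simp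
      \<comment> \<open>The distortion by the Hessenberg matrix and the perturbation cancel exactly,
        for this very N and not only in the limit.\<close>
      also have "\<dots> = p (N - i)" by (subst falling_ratio_fact) auto
      finally show ?thesis by (simp only: p_def)
    qed
    show "degree P \<le> N"
      using degree_monic_char_poly[of "map_mat complex_of_real B" N] B(1) by (simp add: P_def)
    show "size ?E \<le> N" using N(2) by (simp add: n_def)
  qed
  have "Polynomial.order 1 P > 0" using order_P[of 1] by simp
  then have "poly P 1 = 0" by (metis less_numeral_extra(3) order_0I)
  moreover have "poly P 1 = of_real (poly (char_poly B) 1)"
    unfolding P char_poly_similar[OF B(2)] by (simp add: poly_altdef coeff_map_poly)
  ultimately have "eigenvalue B 1"
    using eigenvalue_root_char_poly[OF B(1)] by simp
  then show thesis
    using that[OF B(1) B(3)] order_P unfolding P_def by blast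
qed

subsection \<open>Sufficiency\<close>

lemma pow_mat_commute:
  fixes A :: "'a :: comm_ring_1 mat"
  assumes A: "A \<in> carrier_mat n n"
  shows "A * A ^\<^sub>m k = A ^\<^sub>m k * A"
proof (induction k)
  case (Suc k)
  have Ak: "A ^\<^sub>m k \<in> carrier_mat n n" using A by simp
  have "A * (A ^\<^sub>m k * A) = (A * A ^\<^sub>m k) * A"
    by (rule assoc_mult_mat[OF A Ak A, symmetric])
  then show ?case by (simp add: Suc)
qed (use A in simp)

lemma mat_unit_sandwich:
  assumes X: "X \<in> carrier_mat d d" and ab: "a < d" "b < d" and i: "i < d"
  shows "((c \<cdot>\<^sub>m mat_unit d a b) * X * dagger (c \<cdot>\<^sub>m mat_unit d a b)) $$ (i,i)
    = (if i = a then c * cnj c * X $$ (b,b) else 0)"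
proof -
  let ?K = "c \<cdot>\<^sub>m mat_unit d a b"
  have K: "?K \<in> carrier_mat d d" by simp
  have Kij: "?K $$ (i,j) = (if j = b then (if i = a then c else 0) else 0)" if "i < d" "j < d" for i j
    using that by (simp add: mat_unit_def)
  have D: "dagger ?K \<in> carrier_mat d d" by (simp add: dagger_def mat_unit_def)
  have Dij: "dagger ?K $$ (j,i) = (if j = b then (if i = a then cnj c else 0) else 0)" if "i < d" "j < d" for i j
    using that by (simp add: dagger_def mat_unit_def)
  have KX: "(?K * X) $$ (i,j) = (if i = a then c * X $$ (b,j) else 0)" if "j < d" for j
  proof -
    have "(?K * X) $$ (i,j) = (\<Sum>k<d. if k = b then (if i = a then c * X $$ (k,j) else 0) else 0)"
      unfolding mult_mat_index[OF K X i that] by (rule sum.cong) (use i in \<open>auto simp: Kij\<close>)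
    then show ?thesis using ab by simp
  qed
  have "(?K * X * dagger ?K) $$ (i,i) = (\<Sum>j<d. (?K * X) $$ (i,j) * dagger ?K $$ (j,i))"
    by (rule mult_mat_index[OF mult_carrier_mat[OF K X] D i i])
  also have "\<dots> = (\<Sum>j<d. if j = b then (if i = a then c * cnj c * X $$ (b,b) else 0) else 0)"
    by (rule sum.cong) (use i in \<open>auto simp: KX Dij simp del: index_mult_mat\<close>)
  also have "\<dots> = (if i = a then c * cnj c * X $$ (b,b) else 0)"
    using ab by simp
  finally show ?thesis .
qed

text \<open>The channel with Kraus operators \<open>\<surd>Q\<^sub>b\<^sub>a E\<^sub>a\<^sub>b\<close> annihilates off-diagonal entries and acts on diagonals as the transpose of \<open>Q\<close>.\<close>

lemma classical_channel:
  fixes Q :: "real mat"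
  assumes Q: "Q \<in> carrier_mat d d" and pos: "\<And>i j. i < d \<Longrightarrow> j < d \<Longrightarrow> 0 < Q $$ (i,j)"
    and rows: "\<And>i. i < d \<Longrightarrow> (\<Sum>j<d. Q $$ (i,j)) = 1"
  obtains Ks where "is_kraus_family d Ks" "trace_preserving d (kraus_map d Ks)" "full_kraus_rank d Ks"
    "\<And>k. k \<ge> 1 \<Longrightarrow> mtrace (superop_matrix d (kraus_map d Ks) ^\<^sub>m k) = (\<Sum>i<d. of_real ((Q ^\<^sub>m k) $$ (i,i)))"
proof
  define s where "s = (\<lambda>a b. complex_of_real (sqrt (Q $$ (b,a))))"
  define K where "K = (\<lambda>l. s (l div d) (l mod d) \<cdot>\<^sub>m mat_unit d (l div d) (l mod d))"
  define Ks where "Ks = map K [0..<d * d]"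
  have ss: "s a b * cnj (s a b) = of_real (Q $$ (b,a))" if "a < d" "b < d" for a b
    using pos[OF that(2,1)] by (simp add: s_def less_imp_le flip: of_real_mult)
  have s_nz: "s a b \<noteq> 0" if "a < d" "b < d" for a b
    using pos[OF that(2,1)] by (simp add: s_def)
  have nth: "length Ks = d * d" "\<And>l. l < d * d \<Longrightarrow> Ks ! l = K l"
    by (simp_all add: Ks_def)
  show kraus: "is_kraus_family d Ks"
    by (auto simp: is_kraus_family_def Ks_def K_def)
  show "trace_preserving d (kraus_map d Ks)"
    unfolding trace_preserving_def
  proof
    fix X :: "complex mat" assume X: "X \<in> carrier_mat d d"
    have "mtrace (kraus_map d Ks X) = (\<Sum>i<d. \<Sum>l<d * d. (K l * X * dagger (K l)) $$ (i,i))"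
      by (simp add: mtrace_def kraus_map_def nth)
    also have "\<dots> = (\<Sum>i<d. \<Sum>l<d * d. if i = l div d then of_real (Q $$ (l mod d, l div d)) * X $$ (l mod d, l mod d) else 0)"
      by (intro sum.cong refl) (simp add: K_def mat_unit_sandwich[OF X] div_mod_less_square ss)
    also have "\<dots> = (\<Sum>i<d. \<Sum>a<d. \<Sum>b<d. if i = a then of_real (Q $$ (b,a)) * X $$ (b,b) else 0)"
      by (intro sum.cong refl sum_div_mod)
    also have "\<dots> = (\<Sum>i<d. \<Sum>b<d. \<Sum>a<d. if i = a then of_real (Q $$ (b,a)) * X $$ (b,b) else 0)"
      by (intro sum.cong refl sum.swap)
    also have "\<dots> = (\<Sum>i<d. \<Sum>b<d. of_real (Q $$ (b,i)) * X $$ (b,b))"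
      by (intro sum.cong refl) simp
    also have "\<dots> = (\<Sum>b<d. of_real (\<Sum>i<d. Q $$ (b,i)) * X $$ (b,b))"
      by (subst sum.swap) (simp add: sum_distrib_right)
    also have "\<dots> = mtrace X"
      using X by (simp add: mtrace_def rows)
    finally show "mtrace (kraus_map d Ks X) = mtrace X" .
  qed
  show "full_kraus_rank d Ks"
    unfolding full_kraus_rank_def
  proof (intro ballI exI allI impI)
    fix X :: "complex mat" and i j assume ij: "i < d" "j < d"
    \<comment> \<open>Strict positivity of \<open>Q\<close> enters here: every matrix unit occurs
      with non-zero weight.\<close>
    let ?c = "\<lambda>l. X $$ (l div d, l mod d) / s (l div d) (l mod d)"
    have "(\<Sum>l<length Ks. ?c l * (Ks ! l) $$ (i,j))
        = (\<Sum>l<d * d. if j = l mod d then (if i = l div d then X $$ (l div d, l mod d) else 0) else 0)"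
      by (intro sum.cong) (use ij in \<open>auto simp: nth K_def mat_unit_def s_nz\<close>)
    also have "\<dots> = (\<Sum>a<d. \<Sum>b<d. if j = b then (if i = a then X $$ (a,b) else 0) else 0)"
      by (rule sum_div_mod)
    also have "\<dots> = X $$ (i,j)" using ij by simp
    finally show "X $$ (i,j) = (\<Sum>l<length Ks. ?c l * (Ks ! l) $$ (i,j))" ..
  qed
  define M where "M = cp_matrix d Ks"
  have M: "M \<in> carrier_mat (d * d) (d * d)" by (simp add: M_def)
  have M_pq: "M $$ (p,q) = diag_ind d p * diag_ind d q * of_real (Q $$ (q div d, p div d))"
    if pq: "p < d * d" "q < d * d" for p q
  proof -
    note lt = div_mod_less_square[OF pq(1)] div_mod_less_square[OF pq(2)]
    have "M $$ (p,q) = (\<Sum>l<d * d. K l $$ (p div d, q div d) * cnj (K l $$ (p mod d, q mod d)))"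
      using pq by (simp add: M_def cp_matrix_index Ks_def sum_list_upt_sum comp_def)
    also have "\<dots> = (\<Sum>l<d * d. if l mod d = q div d then (if l div d = p div d then
        diag_ind d p * diag_ind d q * of_real (Q $$ (l mod d, l div d)) else 0) else 0)"
      by (rule sum.cong) (use lt in \<open>auto simp: K_def mat_unit_def diag_ind_def ss\<close>)
    also have "\<dots> = (\<Sum>a<d. \<Sum>b<d. if b = q div d then (if a = p div d then
        diag_ind d p * diag_ind d q * of_real (Q $$ (b, a)) else 0) else 0)"
      by (rule sum_div_mod)
    also have "\<dots> = diag_ind d p * diag_ind d q * of_real (Q $$ (q div d, p div d))"
      using lt by simp
    finally show ?thesis .
  qed
  have diag_div: "(i * d + i) div d = i" "diag_ind d (i * d + i) = 1" if "i < d" for i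
    using that by (simp_all add: diag_ind_def)
  have diag_sq: "diag_ind d p * diag_ind d p = diag_ind d p" for p
    by (simp add: diag_ind_def)
  \<comment> \<open>Exponent 0 is left out, since the identity also fixes the off-diagonal
    coordinates that \<open>M\<close> annihilates.\<close>
  have M_pow: "(M ^\<^sub>m Suc k) $$ (p,q) = diag_ind d p * diag_ind d q * of_real ((Q ^\<^sub>m Suc k) $$ (q div d, p div d))"
    if pq: "p < d * d" "q < d * d" for p q k
    using pq
  proof (induction k arbitrary: q)
    case 0
    have "M ^\<^sub>m Suc 0 = M" "Q ^\<^sub>m Suc 0 = Q" using M Q by simp_all
    then show ?case using M_pq[OF 0] by (simp only:)
  next
    case (Suc k)
    note lt = div_mod_less_square[OF Suc.prems(1)] div_mod_less_square[OF Suc.prems(2)]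
    have Mk: "M ^\<^sub>m Suc k \<in> carrier_mat (d * d) (d * d)" and Qk: "Q ^\<^sub>m Suc k \<in> carrier_mat d d"
      using M Q by (simp_all del: pow_mat.simps)
    have "(M ^\<^sub>m Suc (Suc k)) $$ (p,q) = (\<Sum>r<d * d. (M ^\<^sub>m Suc k) $$ (p,r) * M $$ (r,q))"
      unfolding pow_mat.simps(2)[of M "Suc k"] by (rule mult_mat_index[OF Mk M Suc.prems])
    also have "\<dots> = (\<Sum>r<d * d. diag_ind d r * (diag_ind d p * diag_ind d q *
        of_real ((Q ^\<^sub>m Suc k) $$ (r div d, p div d) * Q $$ (q div d, r div d))))"
    proof (rule sum.cong[OF refl])
      fix r assume "r \<in> {..<d * d}"
      then have r: "r < d * d" by simp
      have "(M ^\<^sub>m Suc k) $$ (p,r) * M $$ (r,q) = (diag_ind d r * diag_ind d r) * (diag_ind d p * diag_ind d q *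
        of_real ((Q ^\<^sub>m Suc k) $$ (r div d, p div d) * Q $$ (q div d, r div d)))"
        unfolding Suc.IH[OF Suc.prems(1) r] M_pq[OF r Suc.prems(2)] of_real_mult by (simp only: mult_ac)
      then show "(M ^\<^sub>m Suc k) $$ (p,r) * M $$ (r,q) = diag_ind d r * (diag_ind d p * diag_ind d q *
        of_real ((Q ^\<^sub>m Suc k) $$ (r div d, p div d) * Q $$ (q div d, r div d)))"
        unfolding diag_sq .
    qed
    also have "\<dots> = (\<Sum>i<d. diag_ind d p * diag_ind d q * of_real ((Q ^\<^sub>m Suc k) $$ (i, p div d) * Q $$ (q div d, i)))"
      unfolding sum_diag_ind by (rule sum.cong) (simp_all only: diag_div lessThan_iff)
    also have "\<dots> = diag_ind d p * diag_ind d q * of_real (\<Sum>i<d. Q $$ (q div d, i) * (Q ^\<^sub>m Suc k) $$ (i, p div d))"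
      by (simp only: of_real_sum sum_distrib_left mult.commute[of "(Q ^\<^sub>m Suc k) $$ _"])
    also have "(\<Sum>i<d. Q $$ (q div d, i) * (Q ^\<^sub>m Suc k) $$ (i, p div d)) = (Q * Q ^\<^sub>m Suc k) $$ (q div d, p div d)"
      by (rule mult_mat_index[OF Q Qk lt(3) lt(1), symmetric])
    also have "Q * Q ^\<^sub>m Suc k = Q ^\<^sub>m Suc (Suc k)"
      unfolding pow_mat_commute[OF Q] by simp
    finally show ?case .
  qed
  fix k :: nat assume k: "k \<ge> 1"
  then obtain m where m: "k = Suc m" by (cases k) auto
  have "mtrace (M ^\<^sub>m k) = (\<Sum>p<d * d. (M ^\<^sub>m Suc m) $$ (p,p))"
    using M by (simp add: mtrace_def m)
  also have "\<dots> = (\<Sum>p<d * d. diag_ind d p * of_real ((Q ^\<^sub>m Suc m) $$ (p div d, p div d)))"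
    by (rule sum.cong) (simp_all only: M_pow diag_sq lessThan_iff)
  also have "\<dots> = (\<Sum>i<d. of_real ((Q ^\<^sub>m k) $$ (i,i)))"
    unfolding sum_diag_ind m by (rule sum.cong) (simp_all only: diag_div lessThan_iff)
  finally show "mtrace (superop_matrix d (kraus_map d Ks) ^\<^sub>m k) = (\<Sum>i<d. of_real ((Q ^\<^sub>m k) $$ (i,i)))"
    unfolding superop_kraus_map[OF kraus] M_def .
qed

text \<open>Conjugation by the diagonal matrix of \<open>v\<close> turns the eigenvector into the
  all-ones vector and leaves the diagonals of all powers unchanged.\<close>

lemma stochastic_rescaling:
  fixes A :: "real mat"
  assumes A: "A \<in> carrier_mat N N" and pos: "\<And>i j. i < N \<Longrightarrow> j < N \<Longrightarrow> 0 < A $$ (i,j)"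
    and v: "\<And>i. i < N \<Longrightarrow> v i > 0" "\<And>i. i < N \<Longrightarrow> (\<Sum>j<N. A $$ (i,j) * v j) = v i"
  obtains Q where "Q \<in> carrier_mat N N" "\<And>i j. i < N \<Longrightarrow> j < N \<Longrightarrow> 0 < Q $$ (i,j)"
    "\<And>i. i < N \<Longrightarrow> (\<Sum>j<N. Q $$ (i,j)) = 1" "\<And>i k. i < N \<Longrightarrow> (Q ^\<^sub>m k) $$ (i,i) = (A ^\<^sub>m k) $$ (i,i)"
proof
  define Q where "Q = mat N N (\<lambda>(i,j). A $$ (i,j) * v j / v i)"
  show Q: "Q \<in> carrier_mat N N" by (simp add: Q_def)
  show "0 < Q $$ (i,j)" if "i < N" "j < N" for i j
    using that pos v(1) by (simp add: Q_def)
  show "(\<Sum>j<N. Q $$ (i,j)) = 1" if "i < N" for i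
    using that v(1)[OF that] v(2)[OF that] by (simp add: Q_def sum_divide_distrib[symmetric])
  have Q_pow: "(Q ^\<^sub>m k) $$ (i,j) = (A ^\<^sub>m k) $$ (i,j) * v j / v i" if "i < N" "j < N" for i j k
    using that
  proof (induction k arbitrary: j)
    case 0
    then show ?case using A Q v(1)[of i] by auto
  next
    case (Suc k)
    have Ak: "A ^\<^sub>m k \<in> carrier_mat N N" and Qk: "Q ^\<^sub>m k \<in> carrier_mat N N" using A Q by simp_all
    have "(Q ^\<^sub>m Suc k) $$ (i,j) = (\<Sum>l<N. (A ^\<^sub>m k) $$ (i,l) * v l / v i * (A $$ (l,j) * v j / v l))"
      unfolding pow_mat.simps mult_mat_index[OF Qk Q Suc.prems]
      by (rule sum.cong) (use Suc in \<open>auto simp: Q_def\<close>)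
    also have "\<dots> = (\<Sum>l<N. (A ^\<^sub>m k) $$ (i,l) * A $$ (l,j) * (v j / v i))"
    proof (rule sum.cong[OF refl])
      fix l assume "l \<in> {..<N}"
      then have "v l \<noteq> 0" using v(1)[of l] by simp
      then show "(A ^\<^sub>m k) $$ (i,l) * v l / v i * (A $$ (l,j) * v j / v l) = (A ^\<^sub>m k) $$ (i,l) * A $$ (l,j) * (v j / v i)"
        by simp
    qed
    finally show ?case
      unfolding pow_mat.simps mult_mat_index[OF Ak A Suc.prems] by (simp add: sum_distrib_right sum_divide_distrib)
  qed
  show "(Q ^\<^sub>m k) $$ (i,i) = (A ^\<^sub>m k) $$ (i,i)" if "i < N" for i k
    using Q_pow[OF that that] v(1)[OF that] by simp
qed

text \<open>From \<open>A\<close> onwards only traces of positive powers are transported, so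
  matrices of the different sizes N and N^2 can be compared without any similarity.\<close>

lemma spectrum_realization:
  fixes L :: "complex multiset"
  assumes L0: "0 \<notin># L" and L: "\<And>z. z \<in># L \<Longrightarrow> cmod z < 1"
    and ps: "\<And>k. k \<ge> 1 \<Longrightarrow> Im (power_sum k (add_mset 1 L)) = 0 \<and> Re (power_sum k (add_mset 1 L)) > 0"
  shows "\<exists>d::nat. \<exists>Ks. is_kraus_family d Ks \<and> trace_preserving d (kraus_map d Ks)
    \<and> full_kraus_rank d Ks \<and> nonzero_spec_eq d (kraus_map d Ks) (add_mset 1 L)"
proof (rule exists_positive_matrix[OF L ps])
  fix N A
  assume A: "A \<in> carrier_mat N N" and pos: "\<And>i j. i < N \<Longrightarrow> j < N \<Longrightarrow> 0 < A $$ (i,j)"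
    and ev: "eigenvalue A 1"
    and ord: "\<And>x. x \<noteq> 0 \<Longrightarrow> Polynomial.order x (char_poly (map_mat complex_of_real A)) = count (add_mset 1 L) x"
  have cA: "map_mat complex_of_real A \<in> carrier_mat N N" using A by simp
  have tr: "(\<Sum>i<N. of_real ((A ^\<^sub>m k) $$ (i,i))) = power_sum k (add_mset 1 L)" if k: "k \<ge> 1" for k
  proof -
    have "\<forall>k\<ge>1. mtrace (map_mat complex_of_real A ^\<^sub>m k) = power_sum k (add_mset 1 L)"
      unfolding nonzero_spectrum_iff_traces[OF cA, symmetric] using ord by blast
    then have "mtrace (map_mat complex_of_real A ^\<^sub>m k) = power_sum k (add_mset 1 L)"
      using k by blast
    moreover have "map_mat complex_of_real A ^\<^sub>m k = map_mat complex_of_real (A ^\<^sub>m k)"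
      by (rule of_real_hom.mat_hom_pow[OF A, symmetric])
    ultimately show ?thesis using A by (simp add: mtrace_def)
  qed
  \<comment> \<open>All prescribed numbers have modulus at most 1, so the traces stay below their
    count. This boundedness rules out the exponential growth in the Perron argument.\<close>
  have tr_le: "(\<Sum>i<N. (A ^\<^sub>m Suc k) $$ (i,i)) \<le> real (size (add_mset 1 L))" for k
  proof -
    have "cmod (power_sum (Suc k) (add_mset 1 L)) \<le> real (size (add_mset 1 L)) * 1 ^ Suc k"
      by (rule cmod_power_sum_le) (use L in \<open>auto intro: less_imp_le\<close>)
    moreover have "complex_of_real (\<Sum>i<N. (A ^\<^sub>m Suc k) $$ (i,i)) = power_sum (Suc k) (add_mset 1 L)"
      unfolding of_real_sum by (rule tr) simp
    ultimately have "cmod (of_real (\<Sum>i<N. (A ^\<^sub>m Suc k) $$ (i,i))) \<le> real (size (add_mset 1 L))"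
      by (simp only: power_one mult_1_right)
    then show ?thesis unfolding norm_of_real by linarith
  qed
  obtain u where u: "u \<in> carrier_vec N" "u \<noteq> 0\<^sub>v N" "A *\<^sub>v u = 1 \<cdot>\<^sub>v u"
    using ev A unfolding eigenvalue_def eigenvector_def by auto
  obtain j0 where j0: "j0 < N" "vec_index u j0 \<noteq> 0"
    using u(1,2) by (metis carrier_vecD eq_vecI index_zero_vec(1) index_zero_vec(2))
  have eig: "(\<Sum>j<N. A $$ (i,j) * vec_index u j) = vec_index u i" if i: "i < N" for i
  proof -
    have "vec_index (A *\<^sub>v u) i = (\<Sum>j<N. A $$ (i,j) * vec_index u j)"
      using i A u(1) by (simp add: scalar_prod_def atLeast0LessThan)
    then show ?thesis using u(1) i by (simp add: u(3))
  qed
  note perron = perron_eigenvector_abs[OF A pos tr_le eig j0]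
  obtain Q where Q: "Q \<in> carrier_mat N N" "\<And>i j. i < N \<Longrightarrow> j < N \<Longrightarrow> 0 < Q $$ (i,j)"
    "\<And>i. i < N \<Longrightarrow> (\<Sum>j<N. Q $$ (i,j)) = 1" "\<And>i k. i < N \<Longrightarrow> (Q ^\<^sub>m k) $$ (i,i) = (A ^\<^sub>m k) $$ (i,i)"
    using stochastic_rescaling[OF A pos perron(2) perron(1)] by blast
  obtain Ks where Ks: "is_kraus_family N Ks" "trace_preserving N (kraus_map N Ks)" "full_kraus_rank N Ks"
    and Ks_tr: "\<And>k. k \<ge> 1 \<Longrightarrow> mtrace (superop_matrix N (kraus_map N Ks) ^\<^sub>m k) = (\<Sum>i<N. of_real ((Q ^\<^sub>m k) $$ (i,i)))"
    using classical_channel[OF Q(1-3)] by blast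
  have "mtrace (superop_matrix N (kraus_map N Ks) ^\<^sub>m k) = power_sum k (add_mset 1 L)" if "k \<ge> 1" for k
    unfolding Ks_tr[OF that] tr[OF that, symmetric] by (rule sum.cong) (simp_all add: Q(4))
  then have "nonzero_spec_eq N (kraus_map N Ks) (add_mset 1 L)"
    unfolding nonzero_spec_eq_def alg_mult_def
    using nonzero_spectrum_iff_traces[of "superop_matrix N (kraus_map N Ks)" "N * N" "add_mset 1 L"] L0
    by (auto simp: superop_matrix_def count_eq_zero_iff)
  then show ?thesis using Ks by blast
qed

theorem theorem7:
  fixes L :: "complex multiset"
  assumes "0 \<notin># L"
  shows "(\<exists>d::nat. \<exists>Ks. is_kraus_family d Ks
            \<and> trace_preserving d (kraus_map d Ks)
            \<and> full_kraus_rank d Ks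
            \<and> nonzero_spec_eq d (kraus_map d Ks) (add_mset 1 L))
         \<longleftrightarrow> ((\<forall>z\<in>#L. cmod z < 1) \<and>
              (\<forall>k::nat. k \<ge> 1 \<longrightarrow> Im (power_sum k (add_mset 1 L)) = 0
                                 \<and> Re (power_sum k (add_mset 1 L)) > 0))"
proof
  assume "\<exists>d::nat. \<exists>Ks. is_kraus_family d Ks
            \<and> trace_preserving d (kraus_map d Ks)
            \<and> full_kraus_rank d Ks
            \<and> nonzero_spec_eq d (kraus_map d Ks) (add_mset 1 L)"
  then show "(\<forall>z\<in>#L. cmod z < 1) \<and>
              (\<forall>k::nat. k \<ge> 1 \<longrightarrow> Im (power_sum k (add_mset 1 L)) = 0
                                 \<and> Re (power_sum k (add_mset 1 L)) > 0)"
    using full_kraus_rank_spectrum by blast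
next
  assume "(\<forall>z\<in>#L. cmod z < 1) \<and>
              (\<forall>k::nat. k \<ge> 1 \<longrightarrow> Im (power_sum k (add_mset 1 L)) = 0
                                 \<and> Re (power_sum k (add_mset 1 L)) > 0)"
  then show "\<exists>d::nat. \<exists>Ks. is_kraus_family d Ks
            \<and> trace_preserving d (kraus_map d Ks)
            \<and> full_kraus_rank d Ks
            \<and> nonzero_spec_eq d (kraus_map d Ks) (add_mset 1 L)"
    by (intro spectrum_realization[OF assms]) blast+
qed

end
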